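(* Let $\ell\ge2$. For every $\omega$-automatic presentation $(L,h)$, with $L\subseteq\Sigma^\omega$, of a $(2,\ell)$-partition $G=(V,E_1,\dots,E_\ell)$ with $|V|=2^{\aleph_0}$, there exists $H\subseteq L$ such that $H\in\mathrm{co}\text{-}\omega\mathrm{erCF}$, $H\in\boldsymbol{\Lambda}$, and $h(H)$ is homogeneous in $G$ with $|h(H)|=2^{\aleph_0}$.
   Context: For a set $V$, $[V]^2$ is the set of 2-element subsets of $V$. A $(2,\ell)$-partition is a tuple $G=(V,E_1,\dots,E_\ell)$ where $(E_1,\dots,E_\ell)$ is a partition of $[V]^2$ into possibly empty sets. A set $W\subseteq V$ is homogeneous if $[W]^2\subseteq E_i$ for some $i$. For $\omega$-words $x_j=a_j^0a_j^1\cdots$ over a finite alphabet, the convolution $(x_1,\dots,x_n)^\otimes$ is the $\omega$-word $(a_1^0,\dots,a_n^0)(a_1^1,\dots,a_n^1)\cdots$. A relation $R$ on $\omega$-words is $\omega$-automatic if the set of convolutions of its tuples is a regular (Büchi-recognizable) $\omega$-language. An $\omega$-automatic presentation of $(V,E_1,\dots,E_\ell)$ is a pair $(L,h)$ with $L\subseteq\Sigma^\omega$ a regular $\omega$-language over a finite alphabet $\Sigma$ and $h:L\to V$ a surjection such that the relations $\{(x,y)\in L^2\mid\{h(x),h(y)\}\in E_i\}$ ($1\le i\le\ell$) and $\{(x,y)\in L^2\mid h(x)=h(y)\}$ are $\omega$-automatic. An $\omega$-language over $\Sigma$ is eventually regular context-free if it is of the form $\bigcup_{1\le i\le n}U_iV_i^\omega$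 with each $U_i$ a context-free language and each $V_i\subseteq\Sigma^+$ a regular language of finite words; $\mathrm{co}\text{-}\omega\mathrm{erCF}$ is the class of $\omega$-languages $H\subseteq\Sigma^\omega$ whose complement $\Sigma^\omega\setminus H$ is eventually regular context-free. Fix a linear order on $\Sigma$ and let $\le_{\mathrm{lex}}$ be the induced lexicographic order on $\Sigma^\omega$. $\boldsymbol{\Lambda}$ is the class of $\omega$-languages $H$ such that the real line $(\mathbb R,\le)$ order-embeds into $(H,\le_{\mathrm{lex}})$. *)

theory Defs
  imports
    Complex_Main
    "HOL-Library.Omega_Words_Fun"
    "HOL-Library.Fun_Lexorder"
    "HOL-Library.Disjoint_Sets"
    "HOL-Library.Equipollence"
    "HOL-Library.Ramsey"
begin

text \<open>
  A finite alphabet is a type of class \<open>finite\<close>, so that the set of all \<open>\<omega>\<close>-words over it is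
  \<open>UNIV :: 'a word set\<close>. A linear order on it is the one of class \<open>linorder\<close>.
\<close>

section \<open>Regular languages of finite and infinite words\<close>

record ('q, 'a) automaton =
  states :: "'q set"
  initial :: "'q set"
  transitions :: "('q \<times> 'a \<times> 'q) set"
  accepting :: "'q set"

definition finite_automaton :: "('q, 'a) automaton \<Rightarrow> bool" where
  "finite_automaton A \<longleftrightarrow>
     finite (states A) \<and> initial A \<subseteq> states A \<and> accepting A \<subseteq> states A \<and>
     transitions A \<subseteq> states A \<times> UNIV \<times> states A"

definition nfa_language :: "('q, 'a) automaton \<Rightarrow> 'a list set" where
  "nfa_language A =
     {w. \<exists>r :: nat \<Rightarrow> 'q. r 0 \<in> initial A \<and>
           (\<forall>i < length w. (r i, w ! i, r (Suc i)) \<in> transitions A) \<and>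
           r (length w) \<in> accepting A}"

definition buechi_language :: "('q, 'a) automaton \<Rightarrow> 'a word set" where
  "buechi_language A =
     {w. \<exists>r :: 'q word. r 0 \<in> initial A \<and>
           (\<forall>i. (r i, w i, r (Suc i)) \<in> transitions A) \<and>
           limit r \<inter> accepting A \<noteq> {}}"

text \<open>States are taken from \<open>nat\<close>, since a definition cannot quantify over types; every finite
  set of states embeds into \<open>nat\<close>. The same holds for the nonterminals of a grammar below.\<close>

definition regular :: "('a :: finite) list set \<Rightarrow> bool" where
  "regular W \<longleftrightarrow> (\<exists>A :: (nat, 'a) automaton. finite_automaton A \<and> W = nfa_language A)"

definition omega_regular :: "('a :: finite) word set \<Rightarrow> bool" where
  "omega_regular L \<longleftrightarrow> (\<exists>A :: (nat, 'a) automaton. finite_automaton A \<and> L = buechi_language A)"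

section \<open>Context-free languages\<close>

record ('n, 'a) grammar =
  start :: 'n
  productions :: "('n \<times> ('n + 'a) list) set"

inductive derives :: "('n, 'a) grammar \<Rightarrow> ('n + 'a) list \<Rightarrow> ('n + 'a) list \<Rightarrow> bool"
  for G :: "('n, 'a) grammar" where
  "(X, \<alpha>) \<in> productions G \<Longrightarrow> derives G (\<beta> @ [Inl X] @ \<gamma>) (\<beta> @ \<alpha> @ \<gamma>)"

definition grammar_language :: "('n, 'a) grammar \<Rightarrow> 'a list set" where
  "grammar_language G = {w. (derives G)\<^sup>*\<^sup>* [Inl (start G)] (map Inr w)}"

definition context_free :: "('a :: finite) list set \<Rightarrow> bool" where
  "context_free U \<longleftrightarrow>
     (\<exists>G :: (nat, 'a) grammar. finite (productions G) \<and> U = grammar_language G)"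

section \<open>Eventually regular context-free \<open>\<omega>\<close>-languages\<close>

text \<open>Consecutive positions of an index sequence (which starts at 0 and is strictly increasing)
  delimit the factors of the word. Hence only nonempty words of \<open>W\<close> can be factors.\<close>

definition omega_power :: "'a list set \<Rightarrow> 'a word set" where
  "omega_power W = {w. \<exists>k. idx_sequence k \<and> (\<forall>i. w [k i \<rightarrow> k (Suc i)] \<in> W)}"

definition omega_erCF :: "('a :: finite) word set set" where
  "omega_erCF =
     {K. \<exists>(n :: nat) (U :: nat \<Rightarrow> 'a list set) (W :: nat \<Rightarrow> 'a list set).
           (\<forall>i \<in> {1..n}. context_free (U i) \<and> regular (W i) \<and> [] \<notin> W i) \<and>
           K = (\<Union>i \<in> {1..n}. {u \<frown> w | u w. u \<in> U i \<and> w \<in> omega_power (W i)})}"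

definition co_omega_erCF :: "('a :: finite) word set set" where
  "co_omega_erCF = {H. - H \<in> omega_erCF}"

section \<open>The lexicographic order\<close>

definition lex_le :: "('a :: linorder) word \<Rightarrow> 'a word \<Rightarrow> bool" where
  "lex_le x y \<longleftrightarrow> x = y \<or> less_fun x y"

definition Lambda_class :: "('a :: {finite, linorder}) word set set" where
  "Lambda_class =
     {H. \<exists>f :: real \<Rightarrow> 'a word. range f \<subseteq> H \<and> (\<forall>s t. s \<le> t \<longleftrightarrow> lex_le (f s) (f t))}"

section \<open>Partitions and their \<open>\<omega>\<close>-automatic presentations\<close>

definition two_partition :: "nat \<Rightarrow> 'v set \<Rightarrow> (nat \<Rightarrow> 'v set set) \<Rightarrow> bool" where
  "two_partition l V E \<longleftrightarrow> (\<Union>i \<in> {1..l}. E i) = [V]\<^bsup>2\<^esup> \<and> disjoint_family_on E {1..l}"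

definition homogeneous :: "nat \<Rightarrow> 'v set \<Rightarrow> (nat \<Rightarrow> 'v set set) \<Rightarrow> 'v set \<Rightarrow> bool" where
  "homogeneous l V E W \<longleftrightarrow> W \<subseteq> V \<and> (\<exists>i \<in> {1..l}. [W]\<^bsup>2\<^esup> \<subseteq> E i)"

definition convolution :: "'a word \<Rightarrow> 'b word \<Rightarrow> ('a \<times> 'b) word" where
  "convolution x y = (\<lambda>n. (x n, y n))"

text \<open>Only binary relations occur in a presentation of a partition.\<close>

definition omega_automatic :: "(('a :: finite) word \<times> 'a word) set \<Rightarrow> bool" where
  "omega_automatic R \<longleftrightarrow> omega_regular {convolution x y | x y. (x, y) \<in> R}"

definition omega_automatic_presentation ::
  "nat \<Rightarrow> 'v set \<Rightarrow> (nat \<Rightarrow> 'v set set) \<Rightarrow> ('a :: finite) word set \<Rightarrow> ('a word \<Rightarrow> 'v) \<Rightarrow> bool" where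
  "omega_automatic_presentation l V E L h \<longleftrightarrow>
     omega_regular L \<and> h ` L = V \<and>
     (\<forall>i \<in> {1..l}. omega_automatic {(x, y). x \<in> L \<and> y \<in> L \<and> {h x, h y} \<in> E i}) \<and>
     omega_automatic {(x, y). x \<in> L \<and> y \<in> L \<and> h x = h y}"

definition has_size_continuum :: "'v set \<Rightarrow> bool" where
  "has_size_continuum W \<longleftrightarrow> W \<approx> (UNIV :: nat set set)"

end

theory Submission
  imports Defs
begin

text \<open>
  Transition profiles of Buechi automata form a finite congruence on finite words, so the colour of a pair
  of \<open>\<omega>\<close>-words depends only on the profiles of the factors in any factorization of its convolution.
  As \<open>V\<close> is uncountable and eventual equality has countable classes, Ramsey's theorem and the pigeonhole
  principle give words \<open>z\<close>, \<open>u\<close>, \<open>v\<close> with \<open>|u| = |v|\<close> such that the profiles \<open>e\<close> of \<open>(u, u)\<close> and \<open>(v, v)\<close>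
  agree, \<open>e\<close> and the profiles \<open>a\<close> of \<open>(u, v)\<close> and \<open>b\<close> of \<open>(v, u)\<close> are idempotent, and
  \<open>z u\<^sup>\<omega>\<close>, \<open>z u v\<^sup>\<omega>\<close> lie in \<open>L\<close> and name different vertices. Passing to the words
  \<open>(u u u)\<^sup>k\<close> and \<open>(u v u)\<^sup>k\<close> for a suitable \<open>k\<close> makes \<open>e\<close> a unit for \<open>a\<close> and \<open>b\<close>. Then a product in which
  \<open>a\<close> and \<open>b\<close> both occur infinitely often is \<open>(a b)\<^sup>\<omega>\<close> or \<open>(b a)\<^sup>\<omega>\<close>, and these two give the same
  colour by symmetry. Encoding the bits \<open>0\<close> and \<open>1\<close> by \<open>u v\<close> and \<open>v u\<close>, any two bit sequences that differ infinitely
  often therefore yield pairs of one fixed colour. The bit sequences with \<open>x (2 n + 1) = x n\<close> for all \<open>n\<close> differ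
  infinitely often as soon as they differ, and a violation of such an equation is witnessed by a prefix
  in a linear context-free language.
\<close>

section \<open>Transition profiles\<close>

text \<open>The flag \<open>True\<close> asserts that some run visits an accepting state, \<open>False\<close> asserts nothing.\<close>

definition profile :: "('q, 'a) automaton \<Rightarrow> 'a list \<Rightarrow> ('q \<times> 'q \<times> bool) set" where
  "profile A w =
     {(p, q, f). \<exists>r. r 0 = p \<and> r (length w) = q \<and> (\<forall>i \<le> length w. r i \<in> states A) \<and>
        (\<forall>i < length w. (r i, w ! i, r (Suc i)) \<in> transitions A) \<and>
        (f \<longrightarrow> (\<exists>i < length w. r i \<in> accepting A))}"

lemma profileI:
  assumes "r 0 = p" "r (length w) = q" "\<And>i. i \<le> length w \<Longrightarrow> r i \<in> states A"
    "\<And>i. i < length w \<Longrightarrow> (r i, w ! i, r (Suc i)) \<in> transitions A"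
    "f \<Longrightarrow> \<exists>i < length w. r i \<in> accepting A"
  shows "(p, q, f) \<in> profile A w"
  unfolding profile_def using assms by (intro CollectI case_prodI exI[of _ r]) blast

lemma profileE:
  assumes "(p, q, f) \<in> profile A w"
  obtains r where "r 0 = p" "r (length w) = q" "\<And>i. i \<le> length w \<Longrightarrow> r i \<in> states A"
    "\<And>i. i < length w \<Longrightarrow> (r i, w ! i, r (Suc i)) \<in> transitions A"
    "f \<Longrightarrow> \<exists>i < length w. r i \<in> accepting A"
  using assms unfolding profile_def mem_Collect_eq case_prod_conv by blast

lemma finite_range_profile:
  assumes "finite_automaton A"
  shows "finite (range (profile A))"
proof (rule finite_subset)
  show "range (profile A) \<subseteq> Pow (states A \<times> states A \<times> UNIV)"
    by (auto simp: profile_def)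
  show "finite (Pow (states A \<times> states A \<times> (UNIV :: bool set)))"
    using assms by (auto simp: finite_automaton_def)
qed

text \<open>Runs can be cut at the end of \<open>u\<close> and glued at a common state. The last
  state of a run is not inspected for acceptance, so consecutive factors count each position exactly
  once.\<close>

lemma profile_append:
  "profile A (u @ v) =
     {(p, s, f). \<exists>q g h. (p, q, g) \<in> profile A u \<and> (q, s, h) \<in> profile A v \<and> (f \<longrightarrow> g \<or> h)}"
proof (intro set_eqI iffI)
  fix z assume z': "z \<in> profile A (u @ v)"
  obtain p s f where z: "z = (p, s, f)" by (cases z)
  obtain r where r: "r 0 = p" "r (length (u @ v)) = s"
    "\<And>i. i \<le> length (u @ v) \<Longrightarrow> r i \<in> states A"
    "\<And>i. i < length (u @ v) \<Longrightarrow> (r i, (u @ v) ! i, r (Suc i)) \<in> transitions A"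
    "f \<Longrightarrow> \<exists>i < length (u @ v). r i \<in> accepting A"
    using z' unfolding z by (erule profileE)
  define g where "g = (\<exists>i < length u. r i \<in> accepting A)"
  define h where "h = (\<exists>i < length v. r (length u + i) \<in> accepting A)"
  have "(p, r (length u), g) \<in> profile A u"
  proof (rule profileI[of r])
    show "(r i, u ! i, r (Suc i)) \<in> transitions A" if "i < length u" for i
      using r(4)[of i] that by (simp add: nth_append)
  qed (use r(1,3) in \<open>auto simp: g_def\<close>)
  moreover have "(r (length u), s, h) \<in> profile A v"
  proof (rule profileI[of "\<lambda>i. r (length u + i)"])
    show "(r (length u + i), v ! i, r (length u + Suc i)) \<in> transitions A" if "i < length v" for i
      using r(4)[of "length u + i"] that by simp
  qed (use r(2,3) in \<open>auto simp: h_def\<close>)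
  moreover have "g \<or> h" if F: f
  proof -
    obtain i where i: "i < length (u @ v)" "r i \<in> accepting A" using r(5) F by blast
    show "g \<or> h"
    proof (cases "i < length u")
      case True
      then show ?thesis using i unfolding g_def by blast
    next
      case False
      then show ?thesis using i unfolding h_def
        by (intro disjI2 exI[of _ "i - length u"]) auto
    qed
  qed
  ultimately show "z \<in> {(p, s, f). \<exists>q g h. (p, q, g) \<in> profile A u \<and> (q, s, h) \<in> profile A v \<and> (f \<longrightarrow> g \<or> h)}"
    unfolding z by blast
next
  fix z assume "z \<in> {(p, s, f). \<exists>q g h. (p, q, g) \<in> profile A u \<and> (q, s, h) \<in> profile A v \<and> (f \<longrightarrow> g \<or> h)}"
  then obtain p s f q g h where z: "z = (p, s, f)"
    and 1: "(p, q, g) \<in> profile A u" and 2: "(q, s, h) \<in> profile A v" and 3: "f \<longrightarrow> g \<or> h"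
    by blast
  obtain r where r: "r 0 = p" "r (length u) = q" "\<And>i. i \<le> length u \<Longrightarrow> r i \<in> states A"
    "\<And>i. i < length u \<Longrightarrow> (r i, u ! i, r (Suc i)) \<in> transitions A"
    "g \<Longrightarrow> \<exists>i < length u. r i \<in> accepting A"
    using 1 by (erule profileE)
  obtain r' where r': "r' 0 = q" "r' (length v) = s" "\<And>i. i \<le> length v \<Longrightarrow> r' i \<in> states A"
    "\<And>i. i < length v \<Longrightarrow> (r' i, v ! i, r' (Suc i)) \<in> transitions A"
    "h \<Longrightarrow> \<exists>i < length v. r' i \<in> accepting A"
    using 2 by (erule profileE)
  define t where "t i = (if i < length u then r i else r' (i - length u))" for i
  have t1: "t i = r i" if "i \<le> length u" for i
    using that r(2) r'(1) by (cases "i = length u") (auto simp: t_def)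
  have t2: "t (length u + i) = r' i" for i
    by (simp add: t_def)
  have "(p, s, f) \<in> profile A (u @ v)"
  proof (rule profileI[of t])
    show "(t i, (u @ v) ! i, t (Suc i)) \<in> transitions A" if "i < length (u @ v)" for i
    proof (cases "i < length u")
      case True
      then show ?thesis using r(4)[of i] t1[of i] t1[of "Suc i"] by (simp add: nth_append)
    next
      case False
      then obtain j where j: "i = length u + j" using le_Suc_ex not_less by blast
      then show ?thesis using r'(4)[of j] t2[of j] t2[of "Suc j"] that by simp
    qed
    show "\<exists>i < length (u @ v). t i \<in> accepting A" if F: f
    proof (cases g)
      case True
      then obtain i where "i < length u" "r i \<in> accepting A" using r(5) by blast
      then show ?thesis using t1[of i] by (intro exI[of _ i]) auto
    next
      case False
      then obtain i where "i < length v" "r' i \<in> accepting A" using r'(5) 3 F by blast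
      then show ?thesis using t2[of i] by (intro exI[of _ "length u + i"]) auto
    qed
    show "t i \<in> states A" if "i \<le> length (u @ v)" for i
      using r(3)[of i] r'(3)[of "i - length u"] that unfolding t_def by auto
    show "t 0 = p" "t (length (u @ v)) = s"
      using t1[of 0] r(1) t2[of "length v"] r'(2) by auto
  qed
  then show "z \<in> profile A (u @ v)" unfolding z .
qed

text \<open>An accepting run on \<open>x\<close> is cut along \<open>k\<close>, and each piece is
  exchanged for a run on the corresponding factor of \<open>x'\<close> with the same end states,
  which meets an accepting state whenever the old piece does. Infinitely many pieces do.\<close>

lemma buechi_language_profile_mono:
  fixes x x' :: "'a word"
  assumes A: "finite_automaton A" and k: "idx_sequence k" and k': "idx_sequence k'"
    and eq: "\<And>i. profile A (subsequence x (k i) (k (Suc i))) = profile A (subsequence x' (k' i) (k' (Suc i)))"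
    and x: "x \<in> buechi_language A"
  shows "x' \<in> buechi_language A"
proof -
  obtain r where r: "r 0 \<in> initial A" "\<And>i. (r i, x i, r (Suc i)) \<in> transitions A"
    "limit r \<inter> accepting A \<noteq> {}"
    using x unfolding buechi_language_def by blast
  have st: "r i \<in> states A" for i
    using r(2)[of i] A unfolding finite_automaton_def by auto
  have fin: "finite (accepting A)"
    using A finite_subset unfolding finite_automaton_def by blast
  have inf: "\<exists>\<^sub>\<infinity>n. r n \<in> accepting A" using r(3) by (rule limit_inter_INF)
  define f where "f i = (\<exists>n. k i \<le> n \<and> n < k (Suc i) \<and> r n \<in> accepting A)" for i
  have klt: "k i < k (Suc i)" "k' i < k' (Suc i)" for i
    using k k' by (auto simp: idx_sequence_def)
  have prof: "(r (k i), r (k (Suc i)), f i) \<in> profile A (subsequence x (k i) (k (Suc i)))" for i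
  proof (rule profileI[of "\<lambda>j. r (k i + j)"])
    assume "f i"
    then obtain n where "k i \<le> n" "n < k (Suc i)" "r n \<in> accepting A"
      unfolding f_def by blast
    then show "\<exists>j < length (subsequence x (k i) (k (Suc i))). r (k i + j) \<in> accepting A"
      by (intro exI[of _ "n - k i"]) auto
  qed (use st r(2) klt(1)[of i] in auto)
  have "\<exists>\<rho>. \<rho> 0 = r (k i) \<and> \<rho> (k' (Suc i) - k' i) = r (k (Suc i)) \<and>
      (\<forall>j < k' (Suc i) - k' i. (\<rho> j, x' (k' i + j), \<rho> (Suc j)) \<in> transitions A) \<and>
      (f i \<longrightarrow> (\<exists>j < k' (Suc i) - k' i. \<rho> j \<in> accepting A))" for i
    using prof[of i] unfolding eq
  proof (rule profileE)
    fix \<rho>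
    assume "\<rho> 0 = r (k i)" "\<rho> (length (subsequence x' (k' i) (k' (Suc i)))) = r (k (Suc i))"
      "\<And>j. j < length (subsequence x' (k' i) (k' (Suc i))) \<Longrightarrow>
         (\<rho> j, subsequence x' (k' i) (k' (Suc i)) ! j, \<rho> (Suc j)) \<in> transitions A"
      "f i \<Longrightarrow> \<exists>j < length (subsequence x' (k' i) (k' (Suc i))). \<rho> j \<in> accepting A"
    then show ?thesis by (intro exI[of _ \<rho>]) simp
  qed
  then obtain \<rho> where \<rho>: "\<And>i. \<rho> i 0 = r (k i)" "\<And>i. \<rho> i (k' (Suc i) - k' i) = r (k (Suc i))"
      "\<And>i j. j < k' (Suc i) - k' i \<Longrightarrow> (\<rho> i j, x' (k' i + j), \<rho> i (Suc j)) \<in> transitions A"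
      "\<And>i. f i \<Longrightarrow> \<exists>j < k' (Suc i) - k' i. \<rho> i j \<in> accepting A"
    by metis
  \<comment> \<open>The block of \<open>x'\<close> that contains position \<open>n\<close>; the
    glued run takes its state at \<open>n\<close> from the piece with this number.\<close>
  define \<iota> where "\<iota> n = (THE i. n \<in> {k' i..<k' (Suc i)})" for n
  have \<iota>: "n \<in> {k' (\<iota> n)..<k' (Suc (\<iota> n))}" for n
    unfolding \<iota>_def by (rule theI') (rule idx_sequence_unique_interval[OF k'])
  define r' where "r' n = \<rho> (\<iota> n) (n - k' (\<iota> n))" for n
  have r'1: "r' (k' i + j) = \<rho> i j" if "j < k' (Suc i) - k' i" for i j
  proof -
    have "\<iota> (k' i + j) = i"
      using that \<iota>[of "k' i + j"] by (intro idx_sequence_interval_unique[OF k' \<iota>]) auto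
    then show ?thesis by (simp add: r'_def)
  qed
  have r'2: "r' (k' i) = r (k i)" for i
    using r'1[of 0 i] klt(2)[of i] \<rho>(1) by simp
  have "(r' n, x' n, r' (Suc n)) \<in> transitions A" for n
  proof -
    define i j where "i = \<iota> n" and "j = n - k' i"
    have n: "n = k' i + j" "j < k' (Suc i) - k' i"
      using \<iota>[of n] unfolding i_def j_def by auto
    have "r' (Suc n) = \<rho> i (Suc j)"
    proof (cases "Suc j < k' (Suc i) - k' i")
      case True
      then show ?thesis using r'1[of "Suc j" i] n by simp
    next
      case False
      then have "Suc j = k' (Suc i) - k' i" "Suc n = k' (Suc i)" using n by auto
      then show ?thesis using r'2[of "Suc i"] \<rho>(2)[of i] by simp
    qed
    then show ?thesis using \<rho>(3)[OF n(2)] r'1[OF n(2)] n(1) by simp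
  qed
  moreover have "r' 0 \<in> initial A"
    using r'2[of 0] k k' r(1) by (simp add: idx_sequence_def)
  moreover have "\<exists>\<^sub>\<infinity>n. r' n \<in> accepting A"
    unfolding INFM_nat_le
  proof
    fix m
    \<comment> \<open>An accepting position from \<open>k m\<close> on lies in a block
      \<open>i \<ge> m\<close>, and block \<open>i\<close> of \<open>x'\<close> starts at
      \<open>k' i \<ge> i\<close>.\<close>
    obtain n where n: "k m \<le> n" "r n \<in> accepting A"
      using inf unfolding INFM_nat_le by blast
    obtain i where i: "n \<in> {k i..<k (Suc i)}" using idx_sequence_interval[OF k] by blast
    have "m \<le> i"
    proof (rule ccontr)
      assume "\<not> m \<le> i"
      then have "k (Suc i) \<le> k m" by (intro idx_sequence_mono[OF k]) simp
      then show False using n i by simp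
    qed
    have "f i" using i n unfolding f_def by auto
    then obtain j where j: "j < k' (Suc i) - k' i" "\<rho> i j \<in> accepting A" using \<rho>(4) by blast
    have "i \<le> k' i" for i
      using klt(2) by (induction i) (auto intro: Suc_leI le_less_trans)
    then have "m \<le> k' i + j" using \<open>m \<le> i\<close> le_trans trans_le_add1 by blast
    then show "\<exists>n\<ge>m. r' n \<in> accepting A" using j r'1[OF j(1)] by metis
  qed
  then have "limit r' \<inter> accepting A \<noteq> {}"
    using fin_ex_inf_eq_limit[OF fin] by blast
  ultimately show ?thesis unfolding buechi_language_def by blast
qed

text \<open>\<open>ty\<close> names the classes of a congruence of finite index, and
  \<open>D\<close> cannot tell apart infinite words with factorizations whose classes agree factor
  by factor. All later combinatorics uses only this.\<close>

definition saturates :: "('b list \<Rightarrow> 't) \<Rightarrow> ('b word \<Rightarrow> 'c) \<Rightarrow> bool" where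
  "saturates ty D \<longleftrightarrow> finite (range ty) \<and>
     (\<forall>u u' v v' :: 'b list. ty u = ty u' \<longrightarrow> ty v = ty v' \<longrightarrow> ty (u @ v) = ty (u' @ v')) \<and>
     (\<forall>(x :: 'b word) (x' :: 'b word) k k'. idx_sequence k \<longrightarrow> idx_sequence k' \<longrightarrow>
        (\<forall>i. ty (subsequence x (k i) (k (Suc i))) = ty (subsequence x' (k' i) (k' (Suc i)))) \<longrightarrow> D x = D x')"

lemma saturates_finite: "saturates ty D \<Longrightarrow> finite (range ty)"
  unfolding saturates_def by (elim conjE)

lemma saturates_append:
  "saturates ty D \<Longrightarrow> ty u = ty u' \<Longrightarrow> ty v = ty v' \<Longrightarrow> ty (u @ v) = ty (u' @ v')"
  unfolding saturates_def by blast

lemma saturates_idx: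
  fixes x x' :: "'b word"
  shows "saturates ty D \<Longrightarrow> idx_sequence k \<Longrightarrow> idx_sequence k' \<Longrightarrow>
   (\<And>i. ty (subsequence x (k i) (k (Suc i))) = ty (subsequence x' (k' i) (k' (Suc i)))) \<Longrightarrow> D x = D x'"
  unfolding saturates_def by blast

text \<open>Listing the profiles of all automata handles them with one congruence; the colour
  collects the indices of the automata that accept.\<close>

lemma saturates_automata:
  fixes A :: "nat \<Rightarrow> (nat, 'b) automaton"
  assumes "\<And>i. i \<le> l \<Longrightarrow> finite_automaton (A i)"
  shows "saturates (\<lambda>w. map (\<lambda>i. profile (A i) w) [0..<Suc l]) (\<lambda>x. {i. i \<le> l \<and> x \<in> buechi_language (A i)})"
    (is "saturates ?ty _")
  unfolding saturates_def
proof (intro conjI allI impI)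
  have ty: "?ty u = ?ty u' \<longleftrightarrow> (\<forall>i\<le>l. profile (A i) u = profile (A i) u')" for u u'
    by (simp only: map_eq_conv set_upt Ball_def atLeastLessThan_iff less_Suc_eq_le) simp
  let ?F = "\<Union>i\<le>l. range (profile (A i))"
  show "finite (range ?ty)"
  proof (rule finite_subset)
    have "set (?ty w) \<subseteq> ?F" for w
      by (simp only: set_map set_upt) (force simp: less_Suc_eq_le)
    then show "range ?ty \<subseteq> {xs. set xs \<subseteq> ?F \<and> length xs = Suc l}"
      by (intro image_subsetI CollectI conjI) (simp_all only: length_map length_upt diff_zero)
    show "finite {xs. set xs \<subseteq> ?F \<and> length xs = Suc l}"
      by (intro finite_lists_length_eq finite_UN_I finite_atMost finite_range_profile assms) simp
  qed
  show "?ty (u @ v) = ?ty (u' @ v')" if "?ty u = ?ty u'" "?ty v = ?ty v'" for u u' v v'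
    using that unfolding ty by (simp add: profile_append)
  fix x x' :: "'b word" and k k'
  assume k: "idx_sequence k" "idx_sequence k'"
    and "\<forall>i. ?ty (subsequence x (k i) (k (Suc i))) = ?ty (subsequence x' (k' i) (k' (Suc i)))"
  then have eq: "profile (A j) (subsequence x (k i) (k (Suc i))) = profile (A j) (subsequence x' (k' i) (k' (Suc i)))"
    if "j \<le> l" for i j
    using that unfolding ty by blast
  have "x \<in> buechi_language (A i) \<longleftrightarrow> x' \<in> buechi_language (A i)" if i: "i \<le> l" for i
  proof
    show "x' \<in> buechi_language (A i)" if x: "x \<in> buechi_language (A i)"
      using assms[OF i] k eq[OF i] x by (rule buechi_language_profile_mono)
    show "x \<in> buechi_language (A i)" if x: "x' \<in> buechi_language (A i)"
      using assms[OF i] k(2,1) eq[OF i, symmetric] x by (rule buechi_language_profile_mono)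
  qed
  then show "{i. i \<le> l \<and> x \<in> buechi_language (A i)} = {i. i \<le> l \<and> x' \<in> buechi_language (A i)}"
    by blast
qed

section \<open>Block substitutions\<close>

lemma infinite_Ramsey_pairs:
  fixes F :: "nat \<Rightarrow> nat \<Rightarrow> 'c"
  assumes "finite C" "\<And>i j. F i j \<in> C"
  obtains Y c where "infinite Y" "\<And>i j. i \<in> Y \<Longrightarrow> j \<in> Y \<Longrightarrow> i < j \<Longrightarrow> F i j = c"
proof -
  obtain g :: "'c \<Rightarrow> nat" and n where g: "g ` C = {i. i < n}" "inj_on g C"
    using finite_imp_inj_to_nat_seg[OF assms(1)] by blast
  have "\<exists>Y t. Y \<subseteq> UNIV \<and> infinite Y \<and> t < n \<and>
      (\<forall>X. X \<subseteq> Y \<and> finite X \<and> card X = 2 \<longrightarrow> (\<lambda>X. g (F (Min X) (Max X))) X = t)"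
  proof (rule Ramsey)
    show "\<forall>X. X \<subseteq> UNIV \<and> finite X \<and> card X = 2 \<longrightarrow> g (F (Min X) (Max X)) < n"
      using g(1) assms(2) by blast
  qed simp
  then obtain Y t where Y: "infinite Y"
    "\<forall>X. X \<subseteq> Y \<and> finite X \<and> card X = 2 \<longrightarrow> g (F (Min X) (Max X)) = t" by blast
  have gt: "g (F i j) = t" if "i \<in> Y" "j \<in> Y" "i < j" for i j
    using Y(2)[rule_format, of "{i, j}"] that by simp
  show ?thesis
  proof
    show "F i j = inv_into C g t" if "i \<in> Y" "j \<in> Y" "i < j" for i j
      using gt[OF that] g(2) assms(2) by auto
  qed (rule Y(1))
qed

text \<open>A pair \<open>i < j\<close> is coloured by the types of the powers with exponent
  \<open>j - i\<close>. For homogeneous \<open>x < y < z\<close> the exponents \<open>y - x\<close>,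
  \<open>z - y\<close> and \<open>z - x\<close> give equal types, and the third power is the product
  of the other two. Colouring by both words at once yields a common exponent.\<close>

lemma idempotent_power:
  fixes ty :: "'b list \<Rightarrow> 't"
  assumes sat: "saturates ty D"
  obtains k where "k > 0"
    "\<And>u. u \<in> {u1, u2} \<Longrightarrow>
       ty (concat (replicate k u) @ concat (replicate k u)) = ty (concat (replicate k u))"
proof -
  let ?p = "\<lambda>k u. concat (replicate k u)"
  let ?F = "\<lambda>i j :: nat. (ty (?p (j - i) u1), ty (?p (j - i) u2))"
  obtain Y c where Y: "infinite Y" "\<And>i j. i \<in> Y \<Longrightarrow> j \<in> Y \<Longrightarrow> i < j \<Longrightarrow> ?F i j = c"
    using infinite_Ramsey_pairs[of "range ty \<times> range ty" ?F] saturates_finite[OF sat] by auto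
  obtain x y z where xyz: "x \<in> Y" "y \<in> Y" "z \<in> Y" "x < y" "y < z"
    using Y(1) unfolding infinite_nat_iff_unbounded by blast
  have eq: "ty (?p (y - x) u) = ty (?p (z - y) u)" "ty (?p (z - x) u) = ty (?p (y - x) u)"
    if "u \<in> {u1, u2}" for u
    using Y(2)[of x y] Y(2)[of y z] Y(2)[of x z] xyz that by auto
  show ?thesis
  proof
    show "y - x > 0" using xyz by simp
    fix u assume u: "u \<in> {u1, u2}"
    have "ty (?p (y - x) u @ ?p (y - x) u) = ty (?p (y - x) u @ ?p (z - y) u)"
      using eq(1)[OF u] by (rule saturates_append[OF sat refl])
    also have "?p (y - x) u @ ?p (z - y) u = ?p (z - x) u"
      using xyz by (simp flip: concat_append replicate_add)
    finally show "ty (?p (y - x) u @ ?p (y - x) u) = ty (?p (y - x) u)"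
      using eq(2)[OF u] by simp
  qed
qed

section \<open>Uniform substitutions on infinite words\<close>

lemma subsequence_split: "i \<le> j \<Longrightarrow> j \<le> k \<Longrightarrow> subsequence w i k = subsequence w i j @ subsequence w j k"
  using upt_add_eq_append[of i j "k - j"] by (simp add: subsequence_def flip: map_append)

text \<open>The image of \<open>w\<close> under the morphism \<open>B\<close> when all blocks have
  length \<open>m\<close>. Written letter by letter, composing and cutting become arithmetic of
  \<open>div\<close> and \<open>mod\<close>.\<close>

definition word_subst :: "nat \<Rightarrow> ('b \<Rightarrow> 'a list) \<Rightarrow> 'b word \<Rightarrow> 'a word" where
  "word_subst m B w = (\<lambda>n. B (w (n div m)) ! (n mod m))"

lemma nth_concat_uniform:
  assumes "\<And>c. c \<in> set l \<Longrightarrow> length (B c) = m" "n < m * length l"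
  shows "concat (map B l) ! n = B (l ! (n div m)) ! (n mod m)"
  using assms
proof (induction l arbitrary: n)
  case (Cons c l)
  show ?case
  proof (cases "n < m")
    case True
    then show ?thesis using Cons.prems by (simp add: nth_append)
  next
    case False
    then have m: "m > 0" using Cons.prems(2) by (cases m) auto
    have "concat (map B l) ! (n - m) = B (l ! ((n - m) div m)) ! ((n - m) mod m)"
      using Cons.prems False by (intro Cons.IH) (auto simp: algebra_simps)
    moreover have "n div m = Suc ((n - m) div m)" using False m by (simp add: le_div_geq)
    moreover have "(n - m) mod m = n mod m" using False by (simp add: le_mod_geq)
    ultimately show ?thesis using Cons.prems False by (simp add: nth_append)
  qed
qed simp

lemma length_concat_uniform:
  "(\<And>c. c \<in> set l \<Longrightarrow> length (B c) = m) \<Longrightarrow> length (concat (map B l)) = m * length l"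
  by (induction l) auto

lemma subsequence_word_subst:
  assumes "\<And>c. length (B c) = m"
  shows "subsequence (word_subst m B w) (m * i) (m * j) = concat (map B (subsequence w i j))"
proof (rule nth_equalityI)
  show "length (subsequence (word_subst m B w) (m * i) (m * j)) = length (concat (map B (subsequence w i j)))"
    using assms by (simp add: length_concat_uniform[of _ B m] diff_mult_distrib2)
  fix n assume "n < length (subsequence (word_subst m B w) (m * i) (m * j))"
  then have n: "n < m * (j - i)" by (simp add: diff_mult_distrib2)
  then have "m > 0" by (cases m) auto
  moreover have "n div m < j - i" using n by (simp add: less_mult_imp_div_less mult.commute)
  ultimately show "subsequence (word_subst m B w) (m * i) (m * j) ! n = concat (map B (subsequence w i j)) ! n"
    using n by (simp add: nth_concat_uniform[of _ B m] assms word_subst_def flip: diff_mult_distrib2)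
qed

lemma word_subst_word_subst:
  assumes "\<And>c. length (B c) = m" "\<And>c. length (C c) = p" "m > 0" "p > 0"
  shows "word_subst m B (word_subst p C w) = word_subst (m * p) (\<lambda>c. concat (map B (C c))) w"
proof
  fix n
  have "n mod (m * p) < m * p" using assms by simp
  moreover have "n mod (m * p) = m * (n div m mod p) + n mod m" by (rule mod_mult2_eq)
  ultimately show "word_subst m B (word_subst p C w) n = word_subst (m * p) (\<lambda>c. concat (map B (C c))) w n"
    using assms by (simp add: word_subst_def nth_concat_uniform[of _ B m] div_mult2_eq)
qed

abbreviation pair_subst :: "('b \<Rightarrow> 'a list) \<Rightarrow> 'b \<times> 'b \<Rightarrow> ('a \<times> 'a) list" where
  "pair_subst B \<equiv> \<lambda>(c, d). zip (B c) (B d)"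

lemma convolution_word_subst:
  assumes "\<And>c. length (B c) = m" "m > 0"
  shows "convolution (word_subst m B \<tau>) (word_subst m B \<sigma>) = word_subst m (pair_subst B) (convolution \<tau> \<sigma>)"
  using assms by (auto simp: convolution_def word_subst_def)

lemma convolution_conc:
  "length u = length v \<Longrightarrow> convolution (u \<frown> x) (v \<frown> y) = zip u v \<frown> convolution x y"
  by (auto simp: convolution_def conc_def)

lemma subsequence_conc: "subsequence (z \<frown> x) (length z + i) (length z + j) = subsequence x i j"
  using subsequence_shift[of "length z" "z \<frown> x" i j] by simp

text \<open>The prefix \<open>z\<close> is merged into the factor of index 0: an index sequence
  starts at 0 and has nonempty factors, while \<open>z\<close> may be empty.\<close>

lemma subsequence_conc_word_subst:
  assumes "\<And>c. length (B c) = m" "k 0 = 0"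
  shows "subsequence (z \<frown> word_subst m B w) (if i = 0 then 0 else length z + m * k i) (length z + m * k (Suc i)) =
    (if i = 0 then z else []) @ concat (map B (subsequence w (k i) (k (Suc i))))"
proof (cases "i = 0")
  case True
  then show ?thesis
    using assms subsequence_word_subst[where B = B and i = 0 and w = w and j = "k (Suc i)", OF assms(1)] by simp
next
  case False
  then show ?thesis
    by (simp add: subsequence_conc subsequence_word_subst[where B = B, OF assms(1)])
qed

text \<open>A factorization of \<open>w\<close> carries over to its image, with \<open>z\<close>
  joining the first factor. This allows whole blocks to be treated as letters.\<close>

lemma saturates_word_subst:
  assumes sat: "saturates ty D" and B: "\<And>c. length (B c) = m" "m > 0"
  shows "saturates (\<lambda>u. ty (concat (map B u))) (\<lambda>w. D (z \<frown> word_subst m B w))"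
  unfolding saturates_def
proof (intro conjI allI impI)
  show "finite (range (\<lambda>u. ty (concat (map B u))))"
    by (rule finite_subset[OF _ saturates_finite[OF sat]]) auto
  show "ty (concat (map B (u @ v))) = ty (concat (map B (u' @ v')))"
    if "ty (concat (map B u)) = ty (concat (map B u'))" "ty (concat (map B v)) = ty (concat (map B v'))"
    for u u' v v'
    using saturates_append[OF sat that] by simp
  fix x x' k k'
  assume k: "idx_sequence k" and k': "idx_sequence k'"
    and eq: "\<forall>i. ty (concat (map B (subsequence x (k i) (k (Suc i))))) =
      ty (concat (map B (subsequence x' (k' i) (k' (Suc i)))))"
  define K where "K k i = (if i = 0 then 0 else length z + m * k i)" for k :: "nat \<Rightarrow> nat" and i
  have idx: "idx_sequence (K k)" if "idx_sequence k" for k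
  proof -
    have "0 < k (Suc 0)" using that unfolding idx_sequence_def by metis
    then show ?thesis using that B(2) by (simp add: idx_sequence_def K_def)
  qed
  have sub: "subsequence (z \<frown> word_subst m B x) (K k i) (K k (Suc i)) =
    (if i = 0 then z else []) @ concat (map B (subsequence x (k i) (k (Suc i))))"
    if "idx_sequence k" for k i x
    using subsequence_conc_word_subst[where B = B, OF B(1), of k] that by (simp add: K_def idx_sequence_def)
  show "D (z \<frown> word_subst m B x) = D (z \<frown> word_subst m B x')"
  proof (rule saturates_idx[OF sat idx[OF k] idx[OF k']])
    show "ty (subsequence (z \<frown> word_subst m B x) (K k i) (K k (Suc i))) =
        ty (subsequence (z \<frown> word_subst m B x') (K k' i) (K k' (Suc i)))" for i
      unfolding sub[OF k] sub[OF k'] using eq by (intro saturates_append[OF sat refl]) blast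
  qed
qed

section \<open>Colourings of pairs of Boolean words\<close>

text \<open>\<open>Q\<close> stands for naming the same vertex: an equivalence relation that, by
  \<open>Q_D\<close>, can be read off the colour of the pair. \<open>D_sym\<close> reflects that
  edges are unordered.\<close>

locale pair_colouring =
  fixes ty :: "('b \<times> 'b) list \<Rightarrow> 't" and D :: "('b \<times> 'b) word \<Rightarrow> 'c"
    and Q :: "'b word \<Rightarrow> 'b word \<Rightarrow> bool"
  assumes sat: "saturates ty D"
    and D_sym: "D (convolution x y) = D (convolution y x)"
    and Q_refl: "Q x x"
    and Q_sym: "Q x y \<Longrightarrow> Q y x"
    and Q_trans: "Q x y \<Longrightarrow> Q y z \<Longrightarrow> Q x z"
    and Q_D: "Q x y \<Longrightarrow> D (convolution x y) = D (convolution x' y') \<Longrightarrow> Q x' y'"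
begin

lemma ty_append: "ty u = ty u' \<Longrightarrow> ty v = ty v' \<Longrightarrow> ty (u @ v) = ty (u' @ v')"
  by (rule saturates_append[OF sat])

lemma ty_Cons: "ty [x] = ty [x'] \<Longrightarrow> ty v = ty v' \<Longrightarrow> ty (x # v) = ty (x' # v')"
  using ty_append[of "[x]" "[x']" v v'] by simp

lemma pair_colouring_word_subst:
  fixes B :: "'d \<Rightarrow> 'b list"
  assumes "\<And>c. length (B c) = m" "m > 0"
  shows "pair_colouring (\<lambda>u. ty (concat (map (pair_subst B) u)))
    (\<lambda>w. D (word_subst m (pair_subst B) w)) (\<lambda>x y. Q (word_subst m B x) (word_subst m B y))"
proof
  show "saturates (\<lambda>u. ty (concat (map (pair_subst B) u))) (\<lambda>w. D (word_subst m (pair_subst B) w))"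
    using saturates_word_subst[OF sat, of "pair_subst B" m "[]"] assms by auto
  fix x y z x' y' :: "'d word"
  let ?B = "word_subst m B"
  note conv = convolution_word_subst[OF assms, symmetric]
  show "D (word_subst m (pair_subst B) (convolution x y)) = D (word_subst m (pair_subst B) (convolution y x))"
    unfolding conv by (rule D_sym)
  show "Q (?B x) (?B x)" by (rule Q_refl)
  show "Q (?B x) (?B y) \<Longrightarrow> Q (?B y) (?B x)" by (rule Q_sym)
  show "Q (?B x) (?B y) \<Longrightarrow> Q (?B y) (?B z) \<Longrightarrow> Q (?B x) (?B z)" by (rule Q_trans)
  show "Q (?B x) (?B y) \<Longrightarrow>
      D (word_subst m (pair_subst B) (convolution x y)) = D (word_subst m (pair_subst B) (convolution x' y')) \<Longrightarrow>
      Q (?B x') (?B y')"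
    unfolding conv by (rule Q_D)
qed

end

text \<open>By \<open>diag\<close> at most three types of letters remain: \<open>e\<close> for equal
  pairs, \<open>a\<close> for \<open>(False, True)\<close> and \<open>b\<close> for
  \<open>(True, False)\<close>.\<close>

locale boolean_pair_colouring = pair_colouring ty D Q
  for ty :: "(bool \<times> bool) list \<Rightarrow> 't" and D :: "(bool \<times> bool) word \<Rightarrow> 'c" and Q +
  assumes diag: "ty [(True, True)] = ty [(False, False)]"
begin

section \<open>Colours when equal pairs act as a unit\<close>

context
  assumes unit: "c \<noteq> d \<Longrightarrow> ty [(False, False), (c, d)] = ty [(c, d)]"
      "c \<noteq> d \<Longrightarrow> ty [(c, d), (False, False)] = ty [(c, d)]"
    and idem: "ty [(c, d), (c, d)] = ty [(c, d)]"
    and not_Q: "\<not> Q (\<lambda>_. False) (\<lambda>_. True)"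
begin

lemma ty_diagonal: "u \<noteq> [] \<Longrightarrow> set u \<subseteq> {(False, False), (True, True)} \<Longrightarrow> ty u = ty [(False, False)]"
proof (induction u)
  case (Cons x u)
  have x: "ty [x] = ty [(False, False)]" 
  proof -
    have "x = (False, False) \<or> x = (True, True)" using Cons.prems(2) by simp
    then show ?thesis using diag by metis
  qed
  show ?case
  proof (cases "u = []")
    case False
    then have "ty (x # u) = ty [(False, False), (False, False)]"
      using Cons.IH Cons.prems(2) by (intro ty_Cons[OF x]) simp
    then show ?thesis using idem by simp
  qed (simp add: x)
qed simp

text \<open>Equal pairs vanish because their type is a unit next to \<open>(c, d)\<close>, and
  repetitions of \<open>(c, d)\<close> merge by idempotence. What follows the last
  \<open>(c, d)\<close> collapses to a single equal pair.\<close>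

lemma ty_absorb:
  assumes "c \<noteq> d" "(c, d) \<in> set u" "(d, c) \<notin> set u"
  shows "ty u = ty [(c, d)]"
  using assms
proof (induction u)
  case (Cons x u)
  consider "x = (c, d)" | "x = (False, False)" | "x = (True, True)"
    using Cons.prems by (cases x) auto
  then have x: "x = (c, d) \<or> ty [x] = ty [(False, False)] \<and> x \<noteq> (c, d)" using diag Cons.prems(1) by cases auto
  show ?case
  proof (cases "(c, d) \<in> set u")
    case True
    then have u: "ty u = ty [(c, d)]" using Cons by auto
    show ?thesis using x
    proof
      assume "x = (c, d)"
      then show ?thesis using ty_Cons[OF refl u, of x] idem by simp
    next
      assume "ty [x] = ty [(False, False)] \<and> x \<noteq> (c, d)"
      then show ?thesis using ty_Cons[OF _ u, of x "(False, False)"] unit(1)[OF \<open>c \<noteq> d\<close>] by simp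
    qed
  next
    case False
    then have xcd: "x = (c, d)" using Cons.prems by auto
    show ?thesis
    proof (cases "u = []")
      case False
      have "set u \<subseteq> {(False, False), (True, True)}"
      proof
        fix y assume "y \<in> set u"
        then have "y \<noteq> (c, d)" "y \<noteq> (d, c)"
          using \<open>(c, d) \<notin> set u\<close> Cons.prems(3) by auto
        then show "y \<in> {(False, False), (True, True)}"
          using \<open>c \<noteq> d\<close> by (cases y; cases c; cases d) auto
      qed
      then have "ty u = ty [(False, False)]" by (rule ty_diagonal[OF False])
      then show ?thesis using ty_Cons[OF refl, of u _ x] xcd unit(2)[OF \<open>c \<noteq> d\<close>] by simp
    qed (use xcd in simp)
  qed
qed simp

text \<open>The word is cut into factors of type \<open>a b\<close>; the alternating word has the
  same factor types when cut into pieces of length 2.\<close>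

lemma D_alternating:
  fixes w :: "(bool \<times> bool) word"
  assumes first: "w p = (False, True)" "\<And>n. n < p \<Longrightarrow> w n \<noteq> (True, False)"
    and inf: "\<exists>\<^sub>\<infinity>n. w n = (False, True)" "\<exists>\<^sub>\<infinity>n. w n = (True, False)"
  shows "D w = D (\<lambda>n. if even n then (False, True) else (True, False))"
proof -
  \<comment> \<open>From \<open>i\<close> on, the next letter that is not an equal pair is
    \<open>(False, True)\<close>. All cuts are made at such positions.\<close>
  define S where "S i \<longleftrightarrow> (\<exists>p\<ge>i. w p = (False, True) \<and> (\<forall>n. i \<le> n \<and> n < p \<longrightarrow> w n \<noteq> (True, False)))" for i
  have step: "\<exists>j. S j \<and> i < j \<and> ty (subsequence w i j) = ty [(False, True), (True, False)]" if "S i" for i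
  proof -
    obtain s where s: "s \<ge> i" "w s = (False, True)" "\<forall>n. i \<le> n \<and> n < s \<longrightarrow> w n \<noteq> (True, False)"
      using \<open>S i\<close> unfolding S_def by blast
    \<comment> \<open>\<open>p\<close> is the first \<open>(True, False)\<close> from
      \<open>i\<close> on and \<open>q\<close> the first \<open>(False, True)\<close> from
      \<open>p\<close> on. So the letters from \<open>i\<close> to \<open>p\<close> have type
      \<open>a\<close> and those from \<open>p\<close> to \<open>q\<close> have type
      \<open>b\<close>.\<close>
    define p where "p = (LEAST n. n \<ge> i \<and> w n = (True, False))"
    have "\<exists>n. n \<ge> i \<and> w n = (True, False)"
      using inf(2) unfolding INFM_nat_le by blast
    then have "p \<ge> i \<and> w p = (True, False)" unfolding p_def by (rule LeastI_ex)
    then have p: "p \<ge> i" "w p = (True, False)" by auto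
    have pmin: "w n \<noteq> (True, False)" if "i \<le> n" "n < p" for n
      using not_less_Least[of n "\<lambda>n. n \<ge> i \<and> w n = (True, False)"] that unfolding p_def by blast
    define q where "q = (LEAST n. n \<ge> p \<and> w n = (False, True))"
    have "\<exists>n. n \<ge> p \<and> w n = (False, True)"
      using inf(1) unfolding INFM_nat_le by blast
    then have "q \<ge> p \<and> w q = (False, True)" unfolding q_def by (rule LeastI_ex)
    then have q: "q \<ge> p" "w q = (False, True)" by auto
    have qmin: "w n \<noteq> (False, True)" if "p \<le> n" "n < q" for n
      using not_less_Least[of n "\<lambda>n. n \<ge> p \<and> w n = (False, True)"] that unfolding q_def by blast
    have "s < p"
      using s p by (metis linorder_neqE_nat prod.inject)
    have "p < q" using q p(2) by (metis le_neq_implies_less prod.inject)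
    have "(False, True) \<in> set (subsequence w i p)"
      using s \<open>s < p\<close> by (auto simp: image_iff intro!: bexI[of _ s])
    moreover have "(True, False) \<notin> set (subsequence w i p)"
      using pmin by (metis atLeastLessThan_iff imageE set_subsequence)
    ultimately have 1: "ty (subsequence w i p) = ty [(False, True)]"
      by (intro ty_absorb) auto
    have "(True, False) \<in> set (subsequence w p q)"
      using p \<open>p < q\<close> by (auto simp: image_iff intro!: bexI[of _ p])
    moreover have "(False, True) \<notin> set (subsequence w p q)"
      using qmin by (metis atLeastLessThan_iff imageE set_subsequence)
    ultimately have 2: "ty (subsequence w p q) = ty [(True, False)]"
      by (intro ty_absorb) auto
    have "subsequence w i q = subsequence w i p @ subsequence w p q"
      using p(1) q(1) by (rule subsequence_split)
    then have "ty (subsequence w i q) = ty [(False, True), (True, False)]"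
      using ty_append[OF 1 2] by simp
    moreover have "S q" unfolding S_def using q(2) by (intro exI[of _ q]) auto
    ultimately show ?thesis using p(1) \<open>p < q\<close> by (intro exI[of _ q]) auto
  qed
  \<comment> \<open>The condition for \<open>n = 0\<close> forces the first cut to be 0, as
    \<open>idx_sequence\<close> demands; \<open>S 0\<close> holds by \<open>first\<close>.\<close>
  have "\<exists>k. \<forall>n. (S (k n) \<and> (n = 0 \<longrightarrow> k n = 0)) \<and>
      (k n < k (Suc n) \<and> ty (subsequence w (k n) (k (Suc n))) = ty [(False, True), (True, False)])"
  proof (rule dependent_nat_choice)
    show "\<exists>x. S x \<and> (0 = (0 :: nat) \<longrightarrow> x = 0)"
      using first unfolding S_def by auto
    fix x n assume "S x \<and> (n = (0 :: nat) \<longrightarrow> x = 0)"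
    then obtain j where "S j" "x < j" "ty (subsequence w x j) = ty [(False, True), (True, False)]"
      using step by blast
    then show "\<exists>y. (S y \<and> (Suc n = 0 \<longrightarrow> y = 0)) \<and>
        x < y \<and> ty (subsequence w x y) = ty [(False, True), (True, False)]"
      by (intro exI[of _ j]) simp
  qed
  then obtain k where k: "idx_sequence k"
    "\<And>n. ty (subsequence w (k n) (k (Suc n))) = ty [(False, True), (True, False)]"
    unfolding idx_sequence_def by blast
  show ?thesis
  proof (rule saturates_idx[OF sat k(1), of "\<lambda>n. 2 * n"])
    show "idx_sequence ((*) 2)" by (simp add: idx_sequence_def)
  qed (simp add: k(2))
qed

text \<open>If the first difference is \<open>(True, False)\<close>, the two words are exchanged,
  which \<open>D_sym\<close> permits. Hence both orders of alternation lead to one colour.\<close>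

lemma D_incomparable:
  assumes "\<exists>\<^sub>\<infinity>n. \<not> x n \<and> y n" "\<exists>\<^sub>\<infinity>n. x n \<and> \<not> y n"
  shows "D (convolution x y) = D (\<lambda>n. if even n then (False, True) else (True, False))"
proof -
  have "\<exists>n. x n \<noteq> y n" using assms(1) unfolding INFM_nat_le by blast
  then obtain p where p: "x p \<noteq> y p" "\<And>n. n < p \<Longrightarrow> x n = y n"
    using exists_least_iff[of "\<lambda>n. x n \<noteq> y n"] by blast
  show ?thesis
  proof (cases "x p")
    case False
    then show ?thesis
      using p assms by (intro D_alternating[of _ p]) (auto simp: convolution_def)
  next
    case True
    then have "D (convolution y x) = D (\<lambda>n. if even n then (False, True) else (True, False))"
      using p assms by (intro D_alternating[of _ p]) (auto simp: convolution_def conj_commute)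
    then show ?thesis using D_sym by simp
  qed
qed

lemma INFM_mod: "r < (3 :: nat) \<Longrightarrow> (\<And>n. n mod 3 = r \<Longrightarrow> P n) \<Longrightarrow> \<exists>\<^sub>\<infinity>n. P n"
  unfolding INFM_nat_le
proof
  fix m assume "r < 3" and P: "\<And>n. n mod 3 = r \<Longrightarrow> P n"
  then show "\<exists>n\<ge>m. P n" by (intro exI[of _ "3 * m + r"]) auto
qed

text \<open>If incomparable words were \<open>Q\<close>-related, then so would be the pairs of
  \<open>(001)\<^sup>\<omega>\<close>, \<open>(110)\<^sup>\<omega>\<close>, \<open>(101)\<^sup>\<omega>\<close>; but the first and the last word are comparable.\<close>

lemma not_Q_incomparable:
  assumes "\<exists>\<^sub>\<infinity>n. \<not> x n \<and> y n" "\<exists>\<^sub>\<infinity>n. x n \<and> \<not> y n"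
  shows "\<not> Q x y"
proof
  assume Q: "Q x y"
  have Q_inc: "Q x' y'" if "\<exists>\<^sub>\<infinity>n. \<not> x' n \<and> y' n" "\<exists>\<^sub>\<infinity>n. x' n \<and> \<not> y' n" for x' y'
    using D_incomparable[OF that] D_incomparable[OF assms] by (intro Q_D[OF Q]) simp
  let ?A = "\<lambda>n :: nat. n mod 3 = 2" and ?B = "\<lambda>n :: nat. n mod 3 \<noteq> 2" and ?C = "\<lambda>n :: nat. n mod 3 \<noteq> 1"
  have "Q ?A ?B" by (intro Q_inc INFM_mod[of 0] INFM_mod[of 2]) auto
  moreover have "Q ?B ?C" by (intro Q_inc; rule INFM_mod[of 1] INFM_mod[of 2]) auto
  ultimately have "Q ?A ?C" by (rule Q_trans)
  \<comment> \<open>Each block of three letters is \<open>(False, True)\<close>,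
    \<open>(False, False)\<close>, \<open>(True, True)\<close> and so has type \<open>a\<close>;
    this gives the colour of the pair excluded by \<open>not_Q\<close>.\<close>
  moreover have "D (convolution ?A ?C) = D (convolution (\<lambda>_. False) (\<lambda>_. True))"
  proof (rule saturates_idx[OF sat, of "\<lambda>n. 3 * n" "\<lambda>n. n"])
    show "idx_sequence ((*) 3)" "idx_sequence (\<lambda>n. n)" by (simp_all add: idx_sequence_def)
    show "ty (subsequence (convolution ?A ?C) (3 * i) (3 * Suc i)) =
        ty (subsequence (convolution (\<lambda>_. False) (\<lambda>_. True)) i (Suc i))" for i
    proof -
      have "ty (subsequence (convolution ?A ?C) (3 * i) (3 * Suc i)) = ty [(False, True)]"
        by (rule ty_absorb) (auto simp: convolution_def image_iff intro!: bexI[of _ "3 * i"])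
      then show ?thesis by (simp add: convolution_def)
    qed
  qed
  ultimately show False using not_Q Q_D by blast
qed

end

end

section \<open>Passing to blocks that make equal pairs a unit\<close>

context boolean_pair_colouring
begin

text \<open>Otherwise \<open>01\<^sup>\<omega>\<close> and \<open>0\<^sup>\<omega>\<close> would both be \<open>Q\<close>-related to \<open>00(110)\<^sup>\<omega>\<close>.\<close>

lemma not_Q_periodic:
  assumes idem: "\<And>c d. ty [(c, d), (c, d)] = ty [(c, d)]"
    and not_Q: "\<not> Q (\<lambda>_. False) (\<lambda>n. n > 0)"
  shows "\<not> Q (\<lambda>_. False) (\<lambda>n. n mod 3 = 1)"
proof
  let ?O = "\<lambda>_ :: nat. False" and ?I = "\<lambda>n :: nat. n > 0"
  let ?P = "\<lambda>n :: nat. n mod 3 = 1" and ?R = "\<lambda>n :: nat. n > 0 \<and> n mod 3 \<noteq> 1"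
  assume Q: "Q ?O ?P"
  \<comment> \<open>The letter \<open>(True, False)\<close> stands at the same positions on both
    sides; elsewhere both have equal pairs, whose types coincide.\<close>
  have "D (convolution ?P ?O) = D (convolution ?I ?R)"
  proof (rule saturates_idx[OF sat, of "\<lambda>n. n" "\<lambda>n. n"])
    show "idx_sequence (\<lambda>n. n)" "idx_sequence (\<lambda>n. n)" by (simp_all add: idx_sequence_def)
    show "ty (subsequence (convolution ?P ?O) i (Suc i)) = ty (subsequence (convolution ?I ?R) i (Suc i))" for i
      using diag by (cases "i = 0"; cases "i mod 3 = 1") (simp_all add: convolution_def)
  qed
  with Q_sym[OF Q] have IR: "Q ?I ?R" by (rule Q_D)
  \<comment> \<open>The first pair is cut into \<open>e a\<close> and then copies of
    \<open>e e a\<close>, the second into \<open>e e a a\<close> and then copies of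
    \<open>e a a\<close>. Idempotence reduces all of these to \<open>e a\<close>.\<close>
  let ?k = "\<lambda>i. case i of 0 \<Rightarrow> 0 | Suc j \<Rightarrow> 3 * j + 2" and ?k' = "\<lambda>i. case i of 0 \<Rightarrow> 0 | Suc j \<Rightarrow> 3 * j + 4"
  have "D (convolution ?O ?P) = D (convolution ?O ?R)"
  proof (rule saturates_idx[OF sat, of ?k ?k'])
    show "idx_sequence ?k" "idx_sequence ?k'" by (auto simp: idx_sequence_def split: nat.split)
    have 1: "ty [(False, False), (False, False), (False, True)] = ty [(False, False), (False, True)]"
      using ty_append[OF idem refl, of False False "[(False, True)]"] by simp
    have 2: "ty [(False, False), (False, True), (False, True)] = ty [(False, False), (False, True)]"
      by (rule ty_Cons[OF refl idem])
    have 3: "ty [(False, False), (False, False), (False, True), (False, True)] = ty [(False, False), (False, True)]"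
      using ty_append[OF idem idem, of False False False True] by simp
    show "ty (subsequence (convolution ?O ?P) (?k i) (?k (Suc i))) =
        ty (subsequence (convolution ?O ?R) (?k' i) (?k' (Suc i)))" for i
    proof (cases i)
      case 0
      have s: "subsequence w 0 2 = [w 0, w 1]" "subsequence w 0 4 = [w 0, w 1, w 2, w 3]" for w :: "(bool \<times> bool) word"
        by (simp_all add: subsequence_def upt_rec numeral_eq_Suc)
      have j: "?k i = 0" "?k (Suc i) = 2" "?k' i = 0" "?k' (Suc i) = 4" using 0 by simp_all
      have "subsequence (convolution ?O ?P) (?k i) (?k (Suc i)) = [(False, False), (False, True)]"
        unfolding j s by (simp add: convolution_def)
      moreover have "subsequence (convolution ?O ?R) (?k' i) (?k' (Suc i)) = [(False, False), (False, False), (False, True), (False, True)]"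
        unfolding j s by (simp add: convolution_def)
      ultimately show ?thesis using 3 by simp
    next
      case (Suc j)
      have s: "subsequence w n (n + 3) = [w n, w (n + 1), w (n + 2)]" for w :: "(bool \<times> bool) word" and n
        by (simp add: numeral_eq_Suc)
      have j: "?k i = 3 * j + 2" "?k (Suc i) = 3 * j + 2 + 3" "?k' i = 3 * j + 4" "?k' (Suc i) = 3 * j + 4 + 3"
        using Suc by simp_all
      have m: "(3 * j + 2) mod 3 = 2" "(3 * j + 2 + 1) mod 3 = 0" "(3 * j + 2 + 2) mod 3 = 1"
        "(3 * j + 4) mod 3 = 1" "(3 * j + 4 + 1) mod 3 = 2" "(3 * j + 4 + 2) mod 3 = 0"
        by presburger+
      have "subsequence (convolution ?O ?P) (?k i) (?k (Suc i)) = [(False, False), (False, False), (False, True)]"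
        unfolding j s convolution_def m by simp
      moreover have "subsequence (convolution ?O ?R) (?k' i) (?k' (Suc i)) = [(False, False), (False, True), (False, True)]"
        unfolding j s convolution_def m by simp
      ultimately show ?thesis using 1 2 by simp
    qed
  qed
  with Q have "Q ?O ?R" by (rule Q_D)
  then show False using Q_trans Q_sym[OF IR] not_Q by blast
qed

lemma ty_power: "ty u = ty v \<Longrightarrow> ty (concat (replicate k u)) = ty (concat (replicate k v))"
proof (induction k)
  case (Suc k)
  show ?case using ty_append[OF Suc.prems Suc.IH[OF Suc.prems]] by simp
qed simp

text \<open>The blocks are powers of \<open>0 c 0\<close>: the outer zeros make \<open>e\<close> a
  unit on both sides, and a suitable power makes the types of unequal pairs idempotent. A final
  recoding of bits by \<open>0 1\<close> and \<open>1 0\<close> turns each difference into two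
  opposite ones.\<close>

lemma ex_uniform_code:
  assumes idem: "\<And>c d. ty [(c, d), (c, d)] = ty [(c, d)]"
    and not_Q: "\<not> Q (\<lambda>_. False) (\<lambda>n. n > 0)"
  obtains m d and B :: "bool \<Rightarrow> bool list" where "m > 0" "\<And>c. length (B c) = m"
    "\<And>x y. \<exists>\<^sub>\<infinity>n. x n \<noteq> y n \<Longrightarrow> D (convolution (word_subst m B x) (word_subst m B y)) = d"
    "\<And>x y. \<exists>\<^sub>\<infinity>n. x n \<noteq> y n \<Longrightarrow> \<not> Q (word_subst m B x) (word_subst m B y)"
proof -
  let ?e = "(False, False)"
  obtain k where "k > 0" and pow: "\<And>u. u \<in> {[?e, (False, True), ?e], [?e, (True, False), ?e]} \<Longrightarrow>
      ty (concat (replicate k u) @ concat (replicate k u)) = ty (concat (replicate k u))"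
    using idempotent_power[OF sat] by metis
  then obtain k' where k: "k = Suc k'" by (cases k) auto
  \<comment> \<open>Paired, the blocks of \<open>c\<close> and \<open>d\<close> form
    \<open>p c d\<close>, which begins and ends with \<open>e\<close>; idempotence of
    \<open>e\<close> therefore absorbs a further \<open>e\<close> on either side.\<close>
  define C where "C c = concat (map (\<lambda>_. [False, c, False]) [0..<k])" for c
  define p where "p c d = concat (replicate k [?e, (c, d), ?e])" for c d
  have len: "length (C c) = 3 * k" for c
    unfolding C_def by (subst length_concat_uniform[where m = 3]) auto
  have k3: "3 * k > 0" using \<open>k > 0\<close> by simp
  have "zip (concat (replicate n [False, c, False])) (concat (replicate n [False, d, False])) =
      concat (replicate n [?e, (c, d), ?e])" for c d n
    by (induction n) auto
  then have zipC: "pair_subst C (c, d) = p c d" for c d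
    unfolding C_def p_def by (simp add: map_replicate_const)
  have e: "ty (replicate (Suc n) ?e) = ty [?e]" for n
  proof (induction n)
    case (Suc n)
    then show ?case using ty_Cons[OF refl Suc, of ?e] idem by simp
  qed simp
  have pe: "ty (p False False) = ty [?e]"
  proof -
    have "concat (replicate n [?e, ?e, ?e]) = replicate (3 * n) ?e" for n
      by (induction n) (auto simp: numeral_3_eq_3)
    then show ?thesis using e[of "3 * k' + 2"] by (simp add: p_def k)
  qed
  have pdiag: "ty (p True True) = ty (p False False)"
    unfolding p_def by (intro ty_power ty_Cons[OF refl] ty_Cons[OF diag] refl)
  have ep: "ty (?e # p c d) = ty (p c d)" for c d
    using ty_append[OF idem refl, of False False "(c, d) # ?e # concat (replicate k' [?e, (c, d), ?e])"]
    by (simp add: p_def k)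
  have "p c d = (concat (replicate k' [?e, (c, d), ?e]) @ [?e, (c, d)]) @ [?e]" for c d
    unfolding p_def k by (induction k') auto
  then have pe': "ty (p c d @ [?e]) = ty (p c d)" for c d
    using ty_append[OF refl idem, of "concat (replicate k' [?e, (c, d), ?e]) @ [?e, (c, d)]" False False] by simp
  interpret L: pair_colouring "\<lambda>u. ty (concat (map (pair_subst C) u))"
    "\<lambda>w. D (word_subst (3 * k) (pair_subst C) w)"
    "\<lambda>x y. Q (word_subst (3 * k) C x) (word_subst (3 * k) C y)"
    by (rule pair_colouring_word_subst[OF len k3])
  interpret L: boolean_pair_colouring "\<lambda>u. ty (concat (map (pair_subst C) u))"
    "\<lambda>w. D (word_subst (3 * k) (pair_subst C) w)"
    "\<lambda>x y. Q (word_subst (3 * k) C x) (word_subst (3 * k) C y)"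
    by unfold_locales (use pdiag zipC in simp)
  have unit: "ty (concat (map (pair_subst C) [(False, False), (c, d)])) = ty (concat (map (pair_subst C) [(c, d)]))"
      "ty (concat (map (pair_subst C) [(c, d), (False, False)])) = ty (concat (map (pair_subst C) [(c, d)]))" for c d
    using zipC ty_append[OF pe refl, of "p c d"] ep ty_append[OF refl pe, of "p c d"] pe' by simp_all
  have idem': "ty (concat (map (pair_subst C) [(c, d), (c, d)])) = ty (concat (map (pair_subst C) [(c, d)]))" for c d
  proof -
    have "ty (p c d @ p c d) = ty (p c d)"
    proof (cases "c = d")
      case True
      then have 1: "ty (p c d) = ty [?e]" using pdiag pe by (cases d) auto
      show ?thesis using ty_append[OF 1 1] idem 1 by simp
    next
      case False
      then show ?thesis unfolding p_def by (intro pow) auto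
    qed
    then show ?thesis using zipC by simp
  qed
  \<comment> \<open>The constant sequences become constantly \<open>False\<close> and periodic with
    period \<open>0 1 0\<close>, so \<open>not_Q_periodic\<close> supplies \<open>not_Q\<close> for
    the recoded colouring.\<close>
  have nthC: "word_subst (3 * k) C (\<lambda>_. c) n = (c \<and> n mod 3 = 1)" for c n
  proof -
    have "n mod (3 * k) < 3 * length [0..<k]" using k3 by simp
    then have "word_subst (3 * k) C (\<lambda>_. c) n = [False, c, False] ! (n mod (3 * k) mod 3)"
      unfolding word_subst_def C_def by (subst nth_concat_uniform[where m = 3]) auto
    also have "n mod (3 * k) mod 3 = n mod 3" by (simp add: mod_mod_cancel)
    also have "[False, c, False] ! (n mod 3) \<longleftrightarrow> c \<and> n mod 3 = 1"
    proof -
      consider "n mod 3 = 0" | "n mod 3 = 1" | "n mod 3 = 2" by linarith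
      then show ?thesis by cases simp_all
    qed
    finally show ?thesis .
  qed
  have not_Q': "\<not> Q (word_subst (3 * k) C (\<lambda>_. False)) (word_subst (3 * k) C (\<lambda>_. True))"
    using not_Q_periodic[OF idem not_Q] unfolding nthC by simp
  \<comment> \<open>A difference at \<open>n\<close> produces \<open>(False, True)\<close> and
    \<open>(True, False)\<close>, in some order, at \<open>2 * n\<close> and
    \<open>2 * n + 1\<close>.\<close>
  define code where "code = word_subst 2 (\<lambda>c. [c, \<not> c])"
  have code: "code x (2 * n) = x n" "code x (2 * n + 1) = (\<not> x n)" for x n
    by (simp_all add: code_def word_subst_def)
  have inc: "\<exists>\<^sub>\<infinity>n. \<not> code x n \<and> code y n" "\<exists>\<^sub>\<infinity>n. code x n \<and> \<not> code y n" if inf: "\<exists>\<^sub>\<infinity>n. x n \<noteq> y n" for x y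
  proof -
    have "(\<exists>n\<ge>m. \<not> code x n \<and> code y n) \<and> (\<exists>n\<ge>m. code x n \<and> \<not> code y n)" for m
    proof -
      obtain n where n: "n \<ge> m" "x n \<noteq> y n" using inf unfolding INFM_nat_le by blast
      have "2 * n \<ge> m" "2 * n + 1 \<ge> m" using n(1) by simp_all
      then show ?thesis using n(2) code by metis
    qed
    then show "\<exists>\<^sub>\<infinity>n. \<not> code x n \<and> code y n" "\<exists>\<^sub>\<infinity>n. code x n \<and> \<not> code y n"
      unfolding INFM_nat_le by blast+
  qed
  let ?B = "\<lambda>c. concat (map C [c, \<not> c])"
  have B: "word_subst (3 * k * 2) ?B x = word_subst (3 * k) C (code x)" for x
    unfolding code_def using k3 by (intro word_subst_word_subst[symmetric] len) auto
  show ?thesis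
  proof (rule that[of "3 * k * 2" ?B])
    show "3 * k * 2 > 0" using k3 by simp
    show "length (?B c) = 3 * k * 2" for c using len by simp
    show "D (convolution (word_subst (3 * k * 2) ?B x) (word_subst (3 * k * 2) ?B y)) =
        D (word_subst (3 * k) (pair_subst C) (\<lambda>n. if even n then (False, True) else (True, False)))"
      if "\<exists>\<^sub>\<infinity>n. x n \<noteq> y n" for x y
      unfolding B convolution_word_subst[OF len k3]
      using unit idem' not_Q' inc[OF that] by (rule L.D_incomparable)
    show "\<not> Q (word_subst (3 * k * 2) ?B x) (word_subst (3 * k * 2) ?B y)"
      if "\<exists>\<^sub>\<infinity>n. x n \<noteq> y n" for x y
      unfolding B using unit idem' not_Q' inc[OF that] by (rule L.not_Q_incomparable)
  qed
qed

end

section \<open>Families of words with a single colour\<close>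

lemma countable_eventually_equal:
  "countable {y :: ('a :: finite) word. \<exists>p. suffix p y = suffix p x}"
proof (rule countable_subset)
  show "{y. \<exists>p. suffix p y = suffix p x} \<subseteq> range (\<lambda>(u, p). u \<frown> suffix p x)"
  proof safe
    fix y p assume "suffix p y = suffix p x"
    then have "y = prefix p y \<frown> suffix p x" using prefix_suffix[of y p] by simp
    then show "y \<in> range (\<lambda>(u, p). u \<frown> suffix p x)" by (intro image_eqI[of _ _ "(prefix p y, p)"]) auto
  qed
qed simp

lemma zip_subsequence: "zip (subsequence x i j) (subsequence y i j) = subsequence (convolution x y) i j"
  by (rule nth_equalityI) (auto simp: convolution_def)

text \<open>Ramsey's theorem synchronizes cuts of finitely many words, and the pigeonhole principle
  selects two with equal diagonal types. Their factors between the first two cuts serve as the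
  images of the two bits, and the Boolean code is composed with them.\<close>

lemma ex_uniform_family:
  fixes D :: "('a :: finite \<times> 'a) word \<Rightarrow> 'c" and h :: "'a word \<Rightarrow> 'v"
  assumes sat: "saturates ty D"
    and L_D: "\<And>x x'. x \<in> L \<Longrightarrow> D (convolution x x) = D (convolution x' x') \<Longrightarrow> x' \<in> L"
    and h_D: "\<And>x y x' y'. x \<in> L \<Longrightarrow> y \<in> L \<Longrightarrow> x' \<in> L \<Longrightarrow> y' \<in> L \<Longrightarrow> h x = h y \<Longrightarrow>
      D (convolution x y) = D (convolution x' y') \<Longrightarrow> h x' = h y'"
    and D_sym: "\<And>x y. x \<in> L \<Longrightarrow> y \<in> L \<Longrightarrow> D (convolution x y) = D (convolution y x)"
    and uncountable: "uncountable (h ` L)"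
  obtains z m d and B :: "bool \<Rightarrow> 'a list" where "m > 0" "\<And>c. length (B c) = m"
    "\<And>x. z \<frown> word_subst m B x \<in> L"
    "\<And>x y. \<exists>\<^sub>\<infinity>n. x n \<noteq> y n \<Longrightarrow> D (convolution (z \<frown> word_subst m B x) (z \<frown> word_subst m B y)) = d"
    "\<And>x y. \<exists>\<^sub>\<infinity>n. x n \<noteq> y n \<Longrightarrow> h (z \<frown> word_subst m B x) \<noteq> h (z \<frown> word_subst m B y)"
proof -
  \<comment> \<open>Each \<open>h (f n)\<close> avoids even the words eventually equal to an earlier \<open>f i\<close>, so that
    below a prefix of \<open>f i\<close> can be replaced without making it equivalent to \<open>f n\<close>.\<close>
  have "\<exists>f. \<forall>n :: nat. f n \<in> L \<and> (\<forall>i<n. \<forall>y\<in>L. (\<exists>p. suffix p y = suffix p (f i)) \<longrightarrow> h y \<noteq> h (f n))"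
  proof (rule dependent_wellorder_choice[where P = "\<lambda>f n r. r \<in> L \<and>
      (\<forall>i<n. \<forall>y\<in>L. (\<exists>p. suffix p y = suffix p (f i)) \<longrightarrow> h y \<noteq> h r)"])
    fix n :: nat and f :: "nat \<Rightarrow> 'a word"
    have "countable (\<Union>i<n. h ` {y. \<exists>p. suffix p y = suffix p (f i)})"
      by (intro countable_UN countable_image countable_eventually_equal) auto
    then have "\<not> h ` L \<subseteq> (\<Union>i<n. h ` {y. \<exists>p. suffix p y = suffix p (f i)})"
      using uncountable countable_subset by blast
    then obtain x where x: "x \<in> L" "h x \<notin> (\<Union>i<n. h ` {y. \<exists>p. suffix p y = suffix p (f i)})" by blast
    show "\<exists>r. r \<in> L \<and> (\<forall>i<n. \<forall>y\<in>L. (\<exists>p. suffix p y = suffix p (f i)) \<longrightarrow> h y \<noteq> h r)"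
    proof (intro exI conjI allI impI ballI)
      fix i y assume "i < n" "\<exists>p. suffix p y = suffix p (f i)"
      then have "h y \<in> (\<Union>i<n. h ` {y. \<exists>p. suffix p y = suffix p (f i)})" by blast
      then show "h y \<noteq> h x" using x(2) by metis
    qed (rule x(1))
  qed simp
  then obtain x :: "nat \<Rightarrow> 'a word" where xL: "\<And>n. x n \<in> L"
    and x: "\<And>i n y p. i < n \<Longrightarrow> y \<in> L \<Longrightarrow> suffix p y = suffix p (x i) \<Longrightarrow> h y \<noteq> h (x n)"
    by blast
  \<comment> \<open>One word more than there are types, so that two of them share a diagonal type.
    The cuts must suit all pairs of these words, as they are chosen before the two words.\<close>
  define N where "N = Suc (card (range ty))"
  define l where "l = List.product [0..<N] [0..<N]"
  let ?F = "\<lambda>i j. map (\<lambda>(p, q). ty (subsequence (convolution (x p) (x q)) i j)) l"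
  obtain Y c where Y: "infinite Y" "\<And>i j. i \<in> Y \<Longrightarrow> j \<in> Y \<Longrightarrow> i < j \<Longrightarrow> ?F i j = c"
  proof (rule infinite_Ramsey_pairs[of _ ?F])
    show "finite {c. set c \<subseteq> range ty \<and> length c = length l}"
      by (intro finite_lists_length_eq saturates_finite[OF sat])
    show "?F i j \<in> {c. set c \<subseteq> range ty \<and> length c = length l}" for i j by auto
  qed blast
  define g where "g = enumerate Y"
  have gY: "g n \<in> Y" and g_less: "g n < g (Suc n)" for n
    unfolding g_def using Y(1) by (simp_all add: enumerate_in_set enumerate_step)
  have gY_less: "g n < g n'" if "n < n'" for n n'
    using that unfolding g_def by (simp add: Y(1))
  have g_eq: "ty (subsequence (convolution (x p) (x q)) (g n) (g n')) =
      ty (subsequence (convolution (x p) (x q)) (g 0) (g 1))" if "p < N" "q < N" "n < n'" for p q n n'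
  proof -
    have "?F (g n) (g n') = ?F (g 0) (g 1)"
      using Y(2)[OF gY gY gY_less[OF \<open>n < n'\<close>]] Y(2)[OF gY gY g_less[of 0]] by simp
    moreover have "(p, q) \<in> set l" using that by (simp add: l_def)
    ultimately show ?thesis by auto
  qed
  have "card ((\<lambda>p. ty (subsequence (convolution (x p) (x p)) (g 0) (g 1))) ` {..<N}) < card {..<N}"
    unfolding N_def card_lessThan less_Suc_eq_le by (intro card_mono saturates_finite[OF sat]) auto
  then have "\<not> inj_on (\<lambda>p. ty (subsequence (convolution (x p) (x p)) (g 0) (g 1))) {..<N}"
    by (rule pigeonhole)
  then obtain p q where pq: "p < N" "q < N" "p \<noteq> q"
    "ty (subsequence (convolution (x p) (x p)) (g 0) (g 1)) = ty (subsequence (convolution (x q) (x q)) (g 0) (g 1))"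
    unfolding inj_on_def by blast
  define i j where "i = min p q" and "j = max p q"
  have ij: "i < j" "j < N"
    "ty (subsequence (convolution (x i) (x i)) (g 0) (g 1)) = ty (subsequence (convolution (x j) (x j)) (g 0) (g 1))"
    using pq by (auto simp: i_def j_def min_def max_def)
  \<comment> \<open>\<open>True\<close> stands for the earlier word \<open>x i\<close>,
    \<open>False\<close> for \<open>x j\<close>. The prefix \<open>z\<close> is always taken from
    \<open>x j\<close>, so that all coded words share it.\<close>
  define X where "X c = (if c then x i else x j)" for c
  define z where "z = prefix (g 0) (x j)"
  define m where "m = g 1 - g 0"
  define U where "U c = subsequence (X c) (g 0) (g 1)" for c
  have m: "m > 0" using g_less[of 0] by (simp add: m_def)
  have U: "length (U c) = m" for c by (simp add: U_def m_def)
  have ty_seg: "ty (subsequence (convolution (X c) (X d)) (g n) (g n')) = ty (pair_subst U (c, d))" if "n < n'" for c d n n'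
    using g_eq[OF _ _ that] ij(1,2) by (simp add: X_def U_def zip_subsequence)
  define y where "y \<tau> = z \<frown> word_subst m U \<tau>" for \<tau>
  have conv_y: "convolution (y \<tau>) (y \<sigma>) = zip z z \<frown> word_subst m (pair_subst U) (convolution \<tau> \<sigma>)" for \<tau> \<sigma>
    unfolding y_def by (simp add: convolution_conc convolution_word_subst[OF U m])
  \<comment> \<open>Transfer between a word \<open>W\<close> cut along \<open>g\<close> and a word
    of blocks cut at multiples of \<open>m\<close>; on both sides the initial part joins the factor
    of index 0.\<close>
  have D_eq: "D (zip z z \<frown> word_subst m (pair_subst U) w) = D W"
    if W: "prefix (g 0) W = zip z z" "\<And>n. ty (subsequence W (g n) (g (Suc n))) = ty (pair_subst U (w n))" for w W
  proof (rule saturates_idx[OF sat, of "\<lambda>i. if i = 0 then 0 else length (zip z z) + m * i" "\<lambda>i. if i = 0 then 0 else g i"])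
    show "idx_sequence (\<lambda>i. if i = 0 then 0 else length (zip z z) + m * i)" "idx_sequence (\<lambda>i. if i = 0 then 0 else g i)"
      using m g_less gY_less[of 0] by (auto simp: idx_sequence_def intro: le_less_trans)
    show "ty (subsequence (zip z z \<frown> word_subst m (pair_subst U) w) (if n = 0 then 0 else length (zip z z) + m * n)
        (if Suc n = 0 then 0 else length (zip z z) + m * Suc n)) =
      ty (subsequence W (if n = 0 then 0 else g n) (if Suc n = 0 then 0 else g (Suc n)))" for n
    proof -
      have "length (pair_subst U c) = m" for c using U by (cases c) simp
      from subsequence_conc_word_subst[where B = "pair_subst U", OF this, of "\<lambda>n. n" "zip z z" w n]
      have 1: "subsequence (zip z z \<frown> word_subst m (pair_subst U) w) (if n = 0 then 0 else length (zip z z) + m * n)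
          (length (zip z z) + m * Suc n) = (if n = 0 then zip z z else []) @ pair_subst U (w n)"
        by simp
      have 2: "subsequence W (if n = 0 then 0 else g n) (g (Suc n)) =
          (if n = 0 then zip z z else []) @ subsequence W (g n) (g (Suc n))"
        using subsequence_append[of W "g 0" "g 1 - g 0"] W(1) g_less[of 0] by simp
      show ?thesis
        by (simp only: nat.distinct if_False 1 2 saturates_append[OF sat refl W(2)])
    qed
  qed
  have pz: "prefix (g 0) (convolution w w) = zip z z" if "prefix (g 0) w = z" for w
    using that zip_subsequence by metis
  \<comment> \<open>This hybrid of \<open>x j\<close> and \<open>x i\<close> is eventually equal to
    \<open>x i\<close>. Once it is known to lie in \<open>L\<close>, the choice of the sequence
    gives \<open>h x' \<noteq> h (x j)\<close>.\<close>
  define x' where "x' n = (if n < g 1 then x j n else x i n)" for n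
  have x'0: "subsequence x' (g 0) (g (Suc 0)) = U False" "prefix (g 0) x' = z"
    using g_less[of 0] by (auto simp: U_def X_def z_def x'_def subsequence_def)
  have x'n: "subsequence x' (g n) (g (Suc n)) = subsequence (X True) (g n) (g (Suc n))" if "n > 0" for n
  proof -
    have "g 1 \<le> g n" using gY_less[of 1 n] that by (cases "n = 1") auto
    then show ?thesis by (auto simp: X_def x'_def subsequence_def)
  qed
  have diag: "ty (pair_subst U (c, c)) = ty (pair_subst U (False, False))" for c
    using ij(3) by (simp add: U_def X_def zip_subsequence)
  have DX: "D (convolution (X False) (X False)) = D (zip z z \<frown> word_subst m (pair_subst U) w)"
    if "\<And>n. fst (w n) = snd (w n)" for w
  proof (rule D_eq[symmetric])
    show "prefix (g 0) (convolution (X False) (X False)) = zip z z"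
      by (rule pz) (simp add: X_def z_def)
    show "ty (subsequence (convolution (X False) (X False)) (g n) (g (Suc n))) = ty (pair_subst U (w n))" for n
      using ty_seg[of n "Suc n" False False] diag[of "fst (w n)"] that[of n] by (cases "w n") simp
  qed
  have x'L: "x' \<in> L"
  proof (rule L_D)
    show "X False \<in> L" by (simp add: X_def xL)
    show "D (convolution (X False) (X False)) = D (convolution x' x')"
    proof (rule trans[OF DX D_eq])
      show "prefix (g 0) (convolution x' x') = zip z z" by (rule pz) (rule x'0)
      show "ty (subsequence (convolution x' x') (g n) (g (Suc n))) = ty (pair_subst U (n > 0, n > 0))" for n
      proof (cases "n > 0")
        case True
        then show ?thesis using ty_seg[of n "Suc n" True True] x'n by (simp flip: zip_subsequence)
      qed (simp add: x'0 flip: zip_subsequence)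
    qed simp
  qed
  have yL: "y \<tau> \<in> L" for \<tau>
  proof (rule L_D)
    show "X False \<in> L" by (simp add: X_def xL)
    show "D (convolution (X False) (X False)) = D (convolution (y \<tau>) (y \<tau>))"
      unfolding conv_y by (rule DX) (simp add: convolution_def)
  qed
  \<comment> \<open>This pair has the factor types of the pair \<open>x j\<close>,
    \<open>x'\<close>, so a common vertex would force \<open>h (x j) = h x'\<close>.\<close>
  have not_Q: "h (y (\<lambda>_. False)) \<noteq> h (y (\<lambda>n. n > 0))"
  proof
    assume eq: "h (y (\<lambda>_. False)) = h (y (\<lambda>n. n > 0))"
    have c: "convolution (\<lambda>_. False) (\<lambda>n :: nat. n > 0) n = (False, n > 0)" for n
      by (simp add: convolution_def)
    have "D (convolution (y (\<lambda>_. False)) (y (\<lambda>n. n > 0))) = D (convolution (X False) x')"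
      unfolding conv_y
    proof (rule D_eq)
      show "prefix (g 0) (convolution (X False) x') = zip z z"
        using x'0(2) by (simp add: X_def z_def flip: zip_subsequence)
      show "ty (subsequence (convolution (X False) x') (g n) (g (Suc n))) =
          ty (pair_subst U (convolution (\<lambda>_. False) (\<lambda>n. n > 0) n))" for n
      proof (cases "n > 0")
        case True
        then show ?thesis using ty_seg[of n "Suc n" False True] x'n by (simp add: c flip: zip_subsequence)
      next
        case False
        then show ?thesis using x'0(1) by (simp add: c U_def flip: zip_subsequence)
      qed
    qed
    then have "h (X False) = h x'"
      using h_D[OF yL yL _ x'L eq, of "X False"] by (simp add: X_def xL)
    moreover have "suffix (g 1) x' = suffix (g 1) (x i)" by (auto simp: x'_def suffix_def)
    ultimately show False using x[OF ij(1) x'L] by (simp add: X_def)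
  qed
  have pU: "length (pair_subst U c) = m" for c using U by (cases c) simp
  interpret C: boolean_pair_colouring "\<lambda>u. ty (concat (map (pair_subst U) u))"
    "\<lambda>w. D (zip z z \<frown> word_subst m (pair_subst U) w)" "\<lambda>\<tau> \<sigma>. h (y \<tau>) = h (y \<sigma>)"
  proof
    show "saturates (\<lambda>u. ty (concat (map (pair_subst U) u))) (\<lambda>w. D (zip z z \<frown> word_subst m (pair_subst U) w))"
      by (rule saturates_word_subst[OF sat pU m])
    show "D (zip z z \<frown> word_subst m (pair_subst U) (convolution \<tau> \<sigma>)) =
        D (zip z z \<frown> word_subst m (pair_subst U) (convolution \<sigma> \<tau>))" for \<tau> \<sigma>
      unfolding conv_y[symmetric] by (rule D_sym[OF yL yL])
    show "h (y \<tau>') = h (y \<sigma>')" if "h (y \<tau>) = h (y \<sigma>)"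
      "D (zip z z \<frown> word_subst m (pair_subst U) (convolution \<tau> \<sigma>)) =
        D (zip z z \<frown> word_subst m (pair_subst U) (convolution \<tau>' \<sigma>'))" for \<tau> \<sigma> \<tau>' \<sigma>'
      using that(2) unfolding conv_y[symmetric] by (rule h_D[OF yL yL yL yL that(1)])
    show "ty (concat (map (pair_subst U) [(True, True)])) = ty (concat (map (pair_subst U) [(False, False)]))"
      using diag by simp
  qed auto
  \<comment> \<open>The intervals between any two of \<open>g 0\<close>, \<open>g 1\<close>,
    \<open>g 2\<close> give one type, and the longest is the concatenation of the other two.\<close>
  have idem: "ty (concat (map (pair_subst U) [(c, d), (c, d)])) = ty (concat (map (pair_subst U) [(c, d)]))" for c d
  proof -
    let ?W = "convolution (X c) (X d)"
    have "ty (pair_subst U (c, d) @ pair_subst U (c, d)) = ty (subsequence ?W (g 0) (g 1) @ subsequence ?W (g 1) (g 2))"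
      by (rule saturates_append[OF sat]) (simp_all only: ty_seg zero_less_one one_less_numeral_iff semiring_norm)
    also have "subsequence ?W (g 0) (g 1) @ subsequence ?W (g 1) (g 2) = subsequence ?W (g 0) (g 2)"
      using gY_less[of 0 1] gY_less[of 1 2] by (intro subsequence_split[symmetric]) auto
    finally show ?thesis using ty_seg[of 0 2 c d] by simp
  qed
  obtain m' and d and B :: "bool \<Rightarrow> bool list" where B: "m' > 0" "\<And>c. length (B c) = m'"
    "\<And>\<tau> \<sigma>. \<exists>\<^sub>\<infinity>n. \<tau> n \<noteq> \<sigma> n \<Longrightarrow> D (zip z z \<frown> word_subst m (pair_subst U)
       (convolution (word_subst m' B \<tau>) (word_subst m' B \<sigma>))) = d"
    "\<And>\<tau> \<sigma>. \<exists>\<^sub>\<infinity>n. \<tau> n \<noteq> \<sigma> n \<Longrightarrow> \<not> h (y (word_subst m' B \<tau>)) = h (y (word_subst m' B \<sigma>))"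
    by (rule C.ex_uniform_code[OF idem not_Q]) (rule that)
  let ?B = "\<lambda>c. concat (map U (B c))"
  have y_eq: "z \<frown> word_subst (m * m') ?B \<tau> = y (word_subst m' B \<tau>)" for \<tau>
    unfolding y_def by (subst word_subst_word_subst[OF U B(2) m B(1)]) simp
  show ?thesis
  proof (rule that[of "m * m'" ?B z d])
    show "m * m' > 0" using m B(1) by simp
    show "length (?B c) = m * m'" for c
      by (subst length_concat_uniform[where m = m]) (simp_all add: U B(2))
  qed (simp_all only: y_eq yL conv_y B not_False_eq_True)
qed

section \<open>A context-free complement\<close>

text \<open>The \<omega>-power of the set of single letters contains every word, so prefixing it by
  a language \<open>U\<close> gives exactly the words with a prefix in \<open>U\<close>.\<close>

lemma regular_letters: "regular (range (\<lambda>a :: 'a :: finite. [a]))"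
proof -
  define A :: "(nat, 'a) automaton" where
    "A = \<lparr>states = {0, 1}, initial = {0}, transitions = {0} \<times> UNIV \<times> {1}, accepting = {1}\<rparr>"
  have "w \<in> nfa_language A \<longleftrightarrow> length w = 1" for w
  proof
    assume "w \<in> nfa_language A"
    then obtain r :: "nat \<Rightarrow> nat" where r: "r 0 = 0" "\<forall>i < length w. r i = 0 \<and> r (Suc i) = 1" "r (length w) = 1"
      unfolding nfa_language_def A_def by (auto simp del: One_nat_def)
    show "length w = 1"
    proof (rule ccontr)
      assume "length w \<noteq> 1"
      moreover have "length w \<noteq> 0" using r(1,3) by (metis zero_neq_one)
      ultimately have "1 < length w" "0 < length w" by linarith+
      then show False using r(2)[rule_format, of 0] r(2)[rule_format, of 1] by simp
    qed
  next
    assume "length w = 1"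
    then show "w \<in> nfa_language A"
      unfolding nfa_language_def A_def by (auto intro!: exI[of _ "\<lambda>i. i"])
  qed
  then have "range (\<lambda>a :: 'a. [a]) = nfa_language A"
    by (auto simp: length_Suc_conv)
  moreover have "finite_automaton A" by (auto simp: finite_automaton_def A_def)
  ultimately show ?thesis unfolding regular_def by blast
qed

lemma omega_power_letters: "omega_power (range (\<lambda>a. [a])) = UNIV"
  by (auto simp: omega_power_def idx_sequence_def intro!: exI[of _ "\<lambda>i. i"])

text \<open>The grammar used below is linear; this fixes the place where a derivation step
  applies.\<close>

lemma single_nonterminal:
  "map Inr u @ Inl A # map Inr v = \<beta> @ Inl Z # \<gamma> \<Longrightarrow> \<beta> = map Inr u \<and> Z = A \<and> \<gamma> = map Inr v"
proof (induction u arbitrary: \<beta>)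
  case Nil
  show ?case
  proof (cases \<beta>)
    case (Cons b \<beta>')
    then have "map Inr v = \<beta>' @ Inl Z # \<gamma>" using Nil by simp
    then have "Inl Z \<in> set (map Inr v)" by simp
    then show ?thesis by auto
  qed (use Nil in auto)
next
  case (Cons a u)
  then show ?case by (cases \<beta>) auto
qed

text \<open>The nonterminal \<open>Suc (to_nat X)\<close> produces \<open>x X y\<close>, where \<open>x\<close> and \<open>y\<close> grow
  by \<open>m\<close> letters at a time.\<close>

lemma context_free_balanced:
  fixes F :: "('a :: finite list \<times> 'a list \<times> 'a list) set"
  assumes "finite F"
  shows "context_free {s @ x @ X @ y @ Y | s x X y Y. (s, X, Y) \<in> F \<and> length x = length y \<and> m dvd length x}"
    (is "context_free ?K")
proof -
  \<comment> \<open>\<open>Suc\<close> keeps 0 free for the start symbol.\<close>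
  define N :: "'a list \<Rightarrow> nat" where "N X = Suc (to_nat X)" for X
  have N: "N X = N X' \<longleftrightarrow> X = X'" "N X \<noteq> 0" for X X' by (simp_all add: N_def)
  define M where "M = (\<lambda>(s, X, Y). X) ` F"
  define P :: "(nat \<times> (nat + 'a) list) set" where
    "P = (\<lambda>(s, X, Y). (0, map Inr s @ Inl (N X) # map Inr Y)) ` F \<union>
      (\<lambda>(X, p, q). (N X, map Inr p @ Inl (N X) # map Inr q)) ` (M \<times> {p. length p = m} \<times> {q. length q = m}) \<union>
      (\<lambda>X. (N X, map Inr X)) ` M"
  define G where "G = \<lparr>start = 0, productions = P\<rparr>"
  have "finite {p :: 'a list. length p = m}"
    using finite_lists_length_eq[of "UNIV :: 'a set" m] by simp
  then have fin: "finite (productions G)"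
    using assms by (auto simp: G_def P_def M_def)
  have derivesI: "derives G (map Inr u @ Inl A # map Inr v) (map Inr u @ \<alpha> @ map Inr v)"
    if "(A, \<alpha>) \<in> P" for A \<alpha> u v
    using derives.intros[of A \<alpha> G "map Inr u" "map Inr v"] that by (simp add: G_def)
  \<comment> \<open>Outer letters are produced first: \<open>x\<close> is consumed from its front,
    \<open>y\<close> from its end.\<close>
  have grow: "(derives G)\<^sup>*\<^sup>* (map Inr s @ Inl (N X) # map Inr Y) (map Inr (s @ x) @ Inl (N X) # map Inr (y @ Y))"
    if "X \<in> M" "length x = m * n" "length y = m * n" for s X Y x y n
    using that
  proof (induction n arbitrary: s Y x y)
    case (Suc n)
    let ?p = "take m x" and ?q = "drop (m * n) y"
    have "(N X, map Inr ?p @ Inl (N X) # map Inr ?q) \<in> P"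
      unfolding P_def using Suc.prems by force
    from derivesI[OF this, of s Y]
    have "derives G (map Inr s @ Inl (N X) # map Inr Y) (map Inr (s @ ?p) @ Inl (N X) # map Inr (?q @ Y))"
      by simp
    moreover have "(derives G)\<^sup>*\<^sup>* (map Inr (s @ ?p) @ Inl (N X) # map Inr (?q @ Y))
        (map Inr ((s @ ?p) @ drop m x) @ Inl (N X) # map Inr (take (m * n) y @ ?q @ Y))"
      using Suc.prems by (intro Suc.IH) auto
    moreover have "(s @ ?p) @ drop m x = s @ x" "take (m * n) y @ ?q @ Y = y @ Y"
      by simp_all
    ultimately show ?case by (metis converse_rtranclp_into_rtranclp)
  qed simp
  have "w \<in> grammar_language G" if w: "w \<in> ?K" for w
  proof -
    obtain s x X y Y where w: "w = s @ x @ X @ y @ Y" "(s, X, Y) \<in> F"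
        and xy: "length x = length y" "m dvd length x"
      using w by blast
    obtain n where n: "length x = m * n" "length y = m * n" using xy by (metis dvdE)
    have X: "X \<in> M" using w(2) unfolding M_def by force
    have "(0, map Inr s @ Inl (N X) # map Inr Y) \<in> P" unfolding P_def using w(2) by force
    from derivesI[OF this, of "[]" "[]"]
    have "derives G [Inl 0] (map Inr s @ Inl (N X) # map Inr Y)" by simp
    also note grow[OF X n]
    also have "(N X, map Inr X) \<in> P" unfolding P_def using X by blast
    from derivesI[OF this, of "s @ x" "y @ Y"]
    have "derives G (map Inr (s @ x) @ Inl (N X) # map Inr (y @ Y)) (map Inr w)"
      by (simp add: w(1))
    finally show ?thesis unfolding grammar_language_def by (simp add: G_def)
  qed
  moreover have "w \<in> ?K" if "w \<in> grammar_language G" for w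
  proof -
    \<comment> \<open>Invariant of derivations: the start symbol, a balanced context around the
      nonterminal of \<open>X\<close>, or a finished word.\<close>
    define I where "I \<alpha> \<longleftrightarrow> \<alpha> = [Inl 0] \<or>
      (\<exists>s x X y Y. (s, X, Y) \<in> F \<and> length x = length y \<and> m dvd length x \<and>
        (\<alpha> = map Inr (s @ x) @ Inl (N X) # map Inr (y @ Y) \<or> \<alpha> = map Inr (s @ x @ X @ y @ Y)))"
      for \<alpha> :: "(nat + 'a) list"
    have step: "I \<alpha>'" if "I \<alpha>" "derives G \<alpha> \<alpha>'" for \<alpha> \<alpha>'
    proof -
      obtain Z \<delta> \<beta> \<gamma> where Z: "(Z, \<delta>) \<in> P" "\<alpha> = \<beta> @ Inl Z # \<gamma>" "\<alpha>' = \<beta> @ \<delta> @ \<gamma>"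
        using \<open>derives G \<alpha> \<alpha>'\<close> by (cases rule: derives.cases) (auto simp: G_def)
      consider "\<alpha> = [Inl 0]"
        | s x X y Y where "(s, X, Y) \<in> F" "length x = length y" "m dvd length x"
            "\<alpha> = map Inr (s @ x) @ Inl (N X) # map Inr (y @ Y)"
        | s x X y Y where "\<alpha> = map Inr (s @ x @ X @ y @ Y)"
        using \<open>I \<alpha>\<close> unfolding I_def by blast
      then show ?thesis
      proof cases
        case 1
        then have "Z = 0" "\<beta> = []" "\<gamma> = []"
          using single_nonterminal[of "[]" 0 "[]" \<beta> Z \<gamma>] Z(2) by auto
        then obtain s X Y where "(s, X, Y) \<in> F" "\<delta> = map Inr s @ Inl (N X) # map Inr Y"
          using Z(1) unfolding P_def N_def by auto
        then show ?thesis
          using Z(3) \<open>\<beta> = []\<close> \<open>\<gamma> = []\<close> unfolding I_def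
          by (intro disjI2 exI[of _ s] exI[of _ "[]"] exI[of _ X] exI[of _ Y]) auto
      next
        case 2
        have Z': "\<beta> = map Inr (s @ x)" "Z = N X" "\<gamma> = map Inr (y @ Y)"
          using single_nonterminal[of "s @ x" "N X" "y @ Y" \<beta> Z \<gamma>] Z(2) 2(4) by auto
        then consider p q where "length p = m" "length q = m" "\<delta> = map Inr p @ Inl (N X) # map Inr q"
          | "\<delta> = map Inr X"
          using Z(1) Z'(2) unfolding P_def N_def by auto
        then show ?thesis
        proof cases
          case (1 p q)
          then have "\<alpha>' = map Inr (s @ x @ p) @ Inl (N X) # map Inr ((q @ y) @ Y)" using Z(3) Z' by simp
          moreover have "length (x @ p) = length (q @ y)" "m dvd length (x @ p)" using 1 2(2,3) by simp_all
          ultimately show ?thesis using 2(1) unfolding I_def by blast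
        next
          case d: 2
          then have "\<alpha>' = map Inr (s @ x @ X @ y @ Y)" using Z(3) Z' by simp
          then show ?thesis using 2(1-3) unfolding I_def by blast
        qed
      next
        case 3
        have "Inl Z \<in> set \<alpha>" using Z(2) by simp
        then show ?thesis using 3 by auto
      qed
    qed
    have "(derives G)\<^sup>*\<^sup>* [Inl 0] (map Inr w)"
      using that by (simp add: grammar_language_def G_def)
    then have "I (map Inr w)"
    proof (induction rule: rtranclp_induct)
      case base
      then show ?case by (simp add: I_def)
    qed (rule step)
    moreover have "map Inr w \<noteq> [Inl 0]" by (cases w) auto
    ultimately obtain s x X y Y where 1: "(s, X, Y) \<in> F" "length x = length y" "m dvd length x"
      and 2: "map Inr w = map Inr (s @ x) @ Inl (N X) # map Inr (y @ Y) \<or>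
        (map Inr w :: (nat + 'a) list) = map Inr (s @ x @ X @ y @ Y)"
      unfolding I_def by blast
    have "map Inr w \<noteq> map Inr (s @ x) @ Inl (N X) # map Inr (y @ Y)"
    proof
      assume "map Inr w = map Inr (s @ x) @ Inl (N X) # map Inr (y @ Y)"
      then have "Inl (N X) \<in> set (map Inr w :: (nat + 'a) list)" by simp
      then show False by auto
    qed
    with 2 have "map Inr w = (map Inr (s @ x @ X @ y @ Y) :: (nat + 'a) list)" by blast
    then have "w = s @ x @ X @ y @ Y" by (simp only: inj_map_eq_map inj_Inr)
    then show ?thesis using 1 by blast
  qed
  ultimately have "?K = grammar_language G" by (intro set_eqI iffI)
  with fin show ?thesis unfolding context_free_def by (intro exI[of _ G] conjI)
qed

text \<open>A word is outside the set iff for some \<open>n\<close> its initial part and its blocks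
  \<open>n\<close> and \<open>2 * n + 1\<close> are not \<open>z\<close>, \<open>B c\<close>,
  \<open>B c\<close> for any bit \<open>c\<close>. Exactly \<open>n\<close> blocks precede block
  \<open>n\<close>, and \<open>n\<close> lie between it and block \<open>2 * n + 1\<close>, so the
  violation is a balanced pattern in a finite prefix.\<close>

lemma co_omega_erCF_self_similar:
  fixes B :: "bool \<Rightarrow> ('a :: finite) list"
  assumes B: "\<And>c. length (B c) = m" "m > 0" "B False \<noteq> B True"
  shows "{z \<frown> word_subst m B x | x. \<forall>n. x (2 * n + 1) = x n} \<in> co_omega_erCF"
    (is "?H \<in> _")
proof -
  \<comment> \<open>Besides unequal blocks this covers a wrong initial part and blocks that code no
    bit.\<close>
  define F where "F = {(s, X, Y). length s = length z \<and> length X = m \<and> length Y = m} - range (\<lambda>c. (z, B c, B c))"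
  define K where "K = {s @ x @ X @ y @ Y | s x X y Y. (s, X, Y) \<in> F \<and> length x = length y \<and> m dvd length x}"
  have fin: "finite {p :: 'a list. length p = n}" for n
    using finite_lists_length_eq[of "UNIV :: 'a set" n] by simp
  have "F \<subseteq> {s. length s = length z} \<times> {X. length X = m} \<times> {Y. length Y = m}"
    by (auto simp: F_def)
  then have "finite F" by (rule finite_subset) (intro finite_cartesian_product fin)
  then have "context_free K" unfolding K_def by (rule context_free_balanced)
  moreover have "- ?H = {u \<frown> w | u w. u \<in> K \<and> w \<in> omega_power (range (\<lambda>a. [a]))}"
  proof (intro set_eqI iffI)
    fix w assume w: "w \<in> {u \<frown> w | u w. u \<in> K \<and> w \<in> omega_power (range (\<lambda>a. [a]))}"
    show "w \<in> - ?H"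
    proof
      assume "w \<in> ?H"
      then obtain b where b: "w = z \<frown> word_subst m B b" "\<And>n. b (2 * n + 1) = b n" by blast
      obtain s x X y Y v where K: "w = (s @ x @ X @ y @ Y) \<frown> v" "(s, X, Y) \<in> F"
        "length x = length y" "m dvd length x"
        using w unfolding K_def by blast
      obtain n where n: "length x = m * n" using K(4) by blast
      have len: "length s = length z" "length X = m" "length Y = m" using K(2) by (auto simp: F_def)
      have blk: "subsequence w (length z + m * i) (length z + m * Suc i) = B (b i)" for i
        unfolding b(1) subsequence_conc by (subst subsequence_word_subst[where B = B, OF B(1)]) simp
      have cut: "subsequence ((u @ V @ r) \<frown> v) (length u) (length u + length V) = V" for u V r
        using subsequence_conc[of u "V \<frown> r \<frown> v" 0 "length V"] by simp
      have "s = z"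
        using arg_cong[OF trans[OF K(1)[symmetric] b(1)], of "prefix (length z)"] len(1) by simp
      moreover have "X = B (b n)"
        using cut[of "s @ x" X "y @ Y"] blk[of n] K(1) n len by (simp add: algebra_simps)
      moreover have "Y = B (b (2 * n + 1))"
      proof -
        have e: "length (s @ x @ X @ y) = length z + m * (2 * n + 1)"
          "length (s @ x @ X @ y) + length Y = length z + m * Suc (2 * n + 1)"
          using K(3) n len by (simp_all add: algebra_simps)
        have "Y = subsequence w (length (s @ x @ X @ y)) (length (s @ x @ X @ y) + length Y)"
          using cut[of "s @ x @ X @ y" Y "[]"] by (simp only: K(1) append_assoc append_Nil2)
        then show ?thesis unfolding e(2) unfolding e(1) blk .
      qed
      ultimately have "(s, X, Y) = (z, B (b n), B (b n))" by (simp only: b(2))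
      then show False using K(2) unfolding F_def by blast
    qed
  next
    fix w assume w: "w \<in> - ?H"
    show "w \<in> {u \<frown> w | u w. u \<in> K \<and> w \<in> omega_power (range (\<lambda>a. [a]))}"
    proof (rule ccontr)
      assume "w \<notin> {u \<frown> w | u w. u \<in> K \<and> w \<in> omega_power (range (\<lambda>a. [a]))}"
      then have notin: "prefix n w \<notin> K" for n
        unfolding omega_power_letters using prefix_suffix[of w n] by blast
      have split5: "prefix e w = prefix a w @ subsequence w a b @ subsequence w b c @ subsequence w c d @ subsequence w d e"
        if "a \<le> b" "b \<le> c" "c \<le> d" "d \<le> e" for a b c d e
        using subsequence_split[of 0 a e w] subsequence_split[of a b e w] subsequence_split[of b c e w]
          subsequence_split[of c d e w] that by simp
      define blk where "blk i = subsequence w (length z + m * i) (length z + m * Suc i)" for i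
      have "\<exists>c. prefix (length z) w = z \<and> blk n = B c \<and> blk (2 * n + 1) = B c" for n
      proof (rule ccontr)
        assume "\<not> ?thesis"
        then have "(prefix (length z) w, blk n, blk (2 * n + 1)) \<in> F"
          by (auto simp: F_def blk_def)
        then have "prefix (length z) w @ subsequence w (length z) (length z + m * n) @ blk n @
            subsequence w (length z + m * Suc n) (length z + m * (2 * n + 1)) @ blk (2 * n + 1) \<in> K"
          unfolding K_def
          by (intro CollectI exI[of _ "prefix (length z) w"] exI[of _ "subsequence w (length z) (length z + m * n)"]
              exI[of _ "blk n"] exI[of _ "blk (2 * n + 1)"] conjI
              exI[of _ "subsequence w (length z + m * Suc n) (length z + m * (2 * n + 1))"])
            (auto simp: algebra_simps)
        moreover have "prefix (length z) w @ subsequence w (length z) (length z + m * n) @ blk n @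
            subsequence w (length z + m * Suc n) (length z + m * (2 * n + 1)) @ blk (2 * n + 1) =
            prefix (length z + m * Suc (2 * n + 1)) w"
          unfolding blk_def by (rule split5[symmetric]) simp_all
        ultimately show False using notin by simp
      qed
      then obtain b where b: "prefix (length z) w = z" "\<And>n. blk n = B (b n)" "\<And>n. blk (2 * n + 1) = B (b n)"
        by metis
      \<comment> \<open>Block \<open>2 * n + 1\<close> is the image of its own bit and of
        \<open>b n\<close>; injectivity identifies these bits.\<close>
      have "B c = B d \<longleftrightarrow> c = d" for c d using B(3) by (cases c; cases d) auto
      then have "b (2 * n + 1) = b n" for n using b(2)[of "2 * n + 1"] b(3)[of n] by simp
      moreover have "w = z \<frown> word_subst m B b"
      proof -
        have "suffix (length z) w = word_subst m B b"
        proof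
          fix n
          have "n mod m < m" using B(2) by simp
          then have "word_subst m B b n = w (length z + m * (n div m) + n mod m)"
            unfolding word_subst_def b(2)[symmetric] blk_def by (subst subsequence_nth) auto
          then show "suffix (length z) w n = word_subst m B b n"
            by (simp add: add.assoc)
        qed
        then show ?thesis using prefix_suffix[of w "length z"] b(1) by simp
      qed
      ultimately show False using w by blast
    qed
  qed
  ultimately have "- ?H \<in> omega_erCF"
    unfolding omega_erCF_def using regular_letters
    by (intro CollectI exI[of _ 1] exI[of _ "\<lambda>_. K"] exI[of _ "\<lambda>_. range (\<lambda>a. [a])"]) auto
  then show ?thesis by (simp add: co_omega_erCF_def)
qed

section \<open>Large homogeneous families\<close>

text \<open>The words \<open>x\<close> with \<open>x (2 * n + 1) = x n\<close> are determined by their letters at even positions, and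
  every letter recurs infinitely often.\<close>

function source :: "nat \<Rightarrow> nat" where
  "source n = (if even n then n div 2 else source (n div 2))"
  by auto

termination by (relation "measure id") (auto elim: oddE)

declare source.simps [simp del]

lemma source_even: "source (2 * n) = n"
  by (subst source.simps) simp

lemma source_odd: "source (2 * n + 1) = source n"
  by (subst source.simps) simp

lemma range_source: "range (\<lambda>A n. source n \<in> A) = {x. \<forall>n. x (2 * n + 1) = x n}"
proof (intro set_eqI iffI)
  fix x :: "nat \<Rightarrow> bool" assume "x \<in> {x. \<forall>n. x (2 * n + 1) = x n}"
  then have x: "x (2 * n + 1) = x n" for n by blast
  have "x n \<longleftrightarrow> source n \<in> {n. x (2 * n)}" for n
  proof (induction n rule: less_induct)
    case (less n)
    consider k where "n = 2 * k" | k where "n = 2 * k + 1" by (metis oddE evenE)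
    then show ?case
    proof cases
      case (2 k)
      then show ?thesis using less[of k] x[of k] source_odd[of k] by simp
    qed (simp add: source_even)
  qed
  then have "x = (\<lambda>n. source n \<in> {n. x (2 * n)})" by blast
  then show "x \<in> range (\<lambda>A n. source n \<in> A)" by blast
qed (auto simp: source_odd[simplified])

text \<open>If \<open>n\<close> has source \<open>k\<close>, so does the later position
  \<open>2 * n + 1\<close>; one element in which the sets differ thus recurs infinitely
  often.\<close>

lemma INFM_source_neq:
  assumes "A \<noteq> A'"
  shows "\<exists>\<^sub>\<infinity>n. (source n \<in> A) \<noteq> (source n \<in> A')"
proof -
  obtain k where k: "(k \<in> A) \<noteq> (k \<in> A')" using assms by blast
  have "\<exists>n\<ge>m. source n = k" for m
  proof (induction m)
    case (Suc m)
    then obtain n where "n \<ge> m" "source n = k" by blast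
    then show ?case by (intro exI[of _ "2 * n + 1"]) (simp add: source_odd[simplified])
  qed (use source_even in blast)
  then show ?thesis unfolding INFM_nat_le using k by metis
qed

text \<open>By inclusion the first differing bit is \<open>False\<close> for \<open>A\<close> and
  \<open>True\<close> for \<open>A'\<close>; inside that block the first difference is at
  \<open>i\<close>.\<close>

lemma less_fun_word_subst:
  fixes B :: "bool \<Rightarrow> ('a :: linorder) list"
  assumes B: "\<And>c. length (B c) = m" "i < m" "B False ! i < B True ! i" "\<And>j. j < i \<Longrightarrow> B False ! j = B True ! j"
    and "A \<subset> A'"
  shows "less_fun (z \<frown> word_subst m B (\<lambda>n. source n \<in> A)) (z \<frown> word_subst m B (\<lambda>n. source n \<in> A'))"
proof -
  let ?x = "\<lambda>n. source n \<in> A" and ?y = "\<lambda>n. source n \<in> A'"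
  obtain k where "k \<in> A'" "k \<notin> A" using assms by blast
  then have "\<exists>n. ?x n \<noteq> ?y n" using source_even by metis
  then obtain n where n: "?x n \<noteq> ?y n" "\<And>p. p < n \<Longrightarrow> ?x p = ?y p"
    using exists_least_iff[of "\<lambda>n. ?x n \<noteq> ?y n"] by blast
  have xy: "\<not> ?x n" "?y n" using n(1) \<open>A \<subset> A'\<close> by auto
  show ?thesis
  proof (rule less_funI, intro exI conjI allI impI)
    have "(n * m + i) div m = n" "(n * m + i) mod m = i" using B(2) by auto
    then show "(z \<frown> word_subst m B ?x) (length z + (n * m + i)) < (z \<frown> word_subst m B ?y) (length z + (n * m + i))"
      using xy B(3) by (simp add: word_subst_def)
    fix p assume p: "p < length z + (n * m + i)"
    show "(z \<frown> word_subst m B ?x) p = (z \<frown> word_subst m B ?y) p"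
    proof (cases "p < length z")
      case False
      define q where "q = p - length z"
      have "q < n * m + i" using p False by (simp add: q_def)
      then consider "q div m < n" | "q div m = n" "q mod m < i"
      proof -
        have "q div m \<le> n"
          using \<open>q < n * m + i\<close> B(2) by (intro less_Suc_eq_le[THEN iffD1] less_mult_imp_div_less) simp
        moreover have "q mod m < i" if "q div m = n"
          using \<open>q < n * m + i\<close> div_mult_mod_eq[of q m] that by simp
        ultimately show ?thesis using that by force
      qed
      then have "B (?x (q div m)) ! (q mod m) = B (?y (q div m)) ! (q mod m)"
      proof cases
        case 2
        then show ?thesis using xy B(4) by simp
      qed (use n(2) in simp)
      then show ?thesis using False by (simp add: word_subst_def q_def)
    qed simp
  qed
qed

text \<open>A real is sent to the set of codes of the rationals below it. These Dedekind cuts form a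
  strict inclusion chain ordered like the reals.\<close>

lemma real_embeds_in_range:
  fixes Y :: "nat set \<Rightarrow> ('a :: {finite, linorder}) word"
  assumes "\<And>A A'. A \<subset> A' \<Longrightarrow> less_fun (Y A) (Y A')"
  shows "range Y \<in> Lambda_class"
proof -
  define f where "f t = Y {n. real_of_rat (from_nat n) < t}" for t
  have less: "less_fun (f s) (f t)" if "s < t" for s t
  proof -
    obtain q where q: "s < of_rat q" "of_rat q < t" using of_rat_dense[OF \<open>s < t\<close>] by blast
    have "{n. real_of_rat (from_nat n) < s} \<subset> {n. real_of_rat (from_nat n) < t}"
    proof (rule psubsetI)
      have "to_nat q \<in> {n. real_of_rat (from_nat n) < t}" "to_nat q \<notin> {n. real_of_rat (from_nat n) < s}"
        using q by auto
      then show "{n. real_of_rat (from_nat n) < s} \<noteq> {n. real_of_rat (from_nat n) < t}" by metis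
    qed (use \<open>s < t\<close> in auto)
    then show ?thesis unfolding f_def by (rule assms)
  qed
  have "s \<le> t \<longleftrightarrow> lex_le (f s) (f t)" for s t
  proof
    assume "s \<le> t"
    then show "lex_le (f s) (f t)" using less[of s t] unfolding lex_le_def by (cases "s = t") auto
  next
    assume le: "lex_le (f s) (f t)"
    show "s \<le> t"
    proof (rule ccontr)
      assume "\<not> s \<le> t"
      then have "less_fun (f t) (f s)" by (intro less) simp
      then show False using le less_fun_asym less_fun_irrefl unfolding lex_le_def by metis
    qed
  qed
  moreover have "range f \<subseteq> range Y" unfolding f_def by blast
  ultimately show ?thesis unfolding Lambda_class_def by blast
qed

section \<open>The homogeneous set of continuum size\<close>

lemma convolution_in_iff: "convolution x y \<in> {convolution x y | x y. (x, y) \<in> R} \<longleftrightarrow> (x, y) \<in> R"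
proof -
  have "x = x' \<and> y = y'" if "convolution x y = convolution x' y'" for x' y'
  proof -
    have "fst \<circ> convolution x y = x" "snd \<circ> convolution x y = y" for x :: "'a word" and y :: "'b word"
      by (auto simp: convolution_def)
    then show ?thesis using that by metis
  qed
  then show ?thesis by blast
qed

lemma uncountable_continuum: "has_size_continuum V \<Longrightarrow> uncountable V"
proof
  assume "has_size_continuum V" "countable V"
  then obtain f :: "_ \<Rightarrow> nat set" where f: "bij_betw f V UNIV"
    unfolding has_size_continuum_def eqpoll_def by blast
  then have "countable (UNIV :: nat set set)"
    using \<open>countable V\<close> by (metis bij_betw_imp_surj_on countable_image)
  then have "range (from_nat_into (UNIV :: nat set set)) = Pow UNIV"
    by (simp add: range_from_nat_into)
  then show False using Cantors_theorem[of "UNIV :: nat set"] by blast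
qed

theorem theorem3p1:
  fixes l :: nat
    and V :: "'v set"
    and E :: "nat \<Rightarrow> 'v set set"
    and L :: "('a :: {finite, linorder}) word set"
    and h :: "'a word \<Rightarrow> 'v"
  assumes "l \<ge> 2"
    and "two_partition l V E"
    and "has_size_continuum V"
    and "omega_automatic_presentation l V E L h"
  shows "\<exists>H. H \<subseteq> L \<and> H \<in> co_omega_erCF \<and> H \<in> Lambda_class \<and>
           homogeneous l V E (h ` H) \<and> has_size_continuum (h ` H)"
proof -
  \<comment> \<open>The edge classes are numbered from 1, so index 0 is free for naming the same
    vertex. On pairs \<open>(x, x)\<close> it tests membership in \<open>L\<close>.\<close>
  define R where "R i = (if i = 0 then {(x, y). x \<in> L \<and> y \<in> L \<and> h x = h y}
    else {(x, y). x \<in> L \<and> y \<in> L \<and> {h x, h y} \<in> E i})" for i :: nat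
  have V: "h ` L = V" using assms(4) by (simp add: omega_automatic_presentation_def)
  have "\<forall>i. \<exists>A :: (nat, 'a \<times> 'a) automaton. i \<le> l \<longrightarrow>
      finite_automaton A \<and> {convolution x y | x y. (x, y) \<in> R i} = buechi_language A"
  proof
    fix i
    have "i \<le> l \<longrightarrow> omega_automatic (R i)"
      using assms(4) unfolding omega_automatic_presentation_def R_def by auto
    then show "\<exists>A :: (nat, 'a \<times> 'a) automaton. i \<le> l \<longrightarrow>
        finite_automaton A \<and> {convolution x y | x y. (x, y) \<in> R i} = buechi_language A"
      unfolding omega_automatic_def omega_regular_def by blast
  qed
  from choice[OF this] obtain A :: "nat \<Rightarrow> (nat, 'a \<times> 'a) automaton" where
    A: "\<And>i. i \<le> l \<Longrightarrow> finite_automaton (A i)"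
    "\<And>i. i \<le> l \<Longrightarrow> {convolution x y | x y. (x, y) \<in> R i} = buechi_language (A i)"
    by blast
  define D where "D w = {i. i \<le> l \<and> w \<in> buechi_language (A i)}" for w
  have D: "i \<in> D (convolution x y) \<longleftrightarrow> i \<le> l \<and> (x, y) \<in> R i" for i x y
    using A(2)[of i] convolution_in_iff[of x y "R i"] unfolding D_def by blast
  have D0: "0 \<in> D (convolution x y) \<longleftrightarrow> x \<in> L \<and> y \<in> L \<and> h x = h y" for x y
    unfolding D by (simp add: R_def)
  have sat: "saturates (\<lambda>w. map (\<lambda>i. profile (A i) w) [0..<Suc l]) D"
    unfolding D_def using A(1) by (rule saturates_automata)
  have L_D: "x' \<in> L" if "x \<in> L" "D (convolution x x) = D (convolution x' x')" for x x'
    using D0[of x x] D0[of x' x'] that by simp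
  have h_D: "h x' = h y'" if "x \<in> L" "y \<in> L" "h x = h y" "D (convolution x y) = D (convolution x' y')" for x y x' y'
    using D0[of x y] D0[of x' y'] that by simp
  have D_sym: "D (convolution x y) = D (convolution y x)" for x y
  proof (rule set_eqI)
    show "i \<in> D (convolution x y) \<longleftrightarrow> i \<in> D (convolution y x)" for i
      unfolding D R_def by (auto simp: insert_commute)
  qed
  have unc: "uncountable (h ` L)" unfolding V using assms(3) by (rule uncountable_continuum)
  obtain z m d and B :: "bool \<Rightarrow> 'a list" where m: "m > 0" and B: "\<And>c. length (B c) = m"
    and BL: "\<And>x. z \<frown> word_subst m B x \<in> L"
    and BD: "\<And>x y. \<exists>\<^sub>\<infinity>n. x n \<noteq> y n \<Longrightarrow>
      D (convolution (z \<frown> word_subst m B x) (z \<frown> word_subst m B y)) = d"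
    and Bh: "\<And>x y. \<exists>\<^sub>\<infinity>n. x n \<noteq> y n \<Longrightarrow> h (z \<frown> word_subst m B x) \<noteq> h (z \<frown> word_subst m B y)"
    by (rule ex_uniform_family[OF sat L_D h_D D_sym unc]) (assumption | rule that)+
  have "B False \<noteq> B True"
  proof
    assume "B False = B True"
    then have "word_subst m B (\<lambda>_. False) = word_subst m B (\<lambda>_. True)" by (simp add: word_subst_def)
    then show False using Bh[of "\<lambda>_. False" "\<lambda>_. True"] by simp
  qed
  then have "\<exists>i. i < m \<and> B False ! i \<noteq> B True ! i" using B by (metis nth_equalityI)
  then obtain i where i: "i < m" "B False ! i \<noteq> B True ! i" "\<And>j. j < i \<Longrightarrow> B False ! j = B True ! j"
    using exists_least_iff[of "\<lambda>i. i < m \<and> B False ! i \<noteq> B True ! i"] by (metis less_trans)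
  \<comment> \<open>If \<open>B True\<close> is smaller at the first difference, the blocks are
    swapped, so that \<open>C False\<close> precedes \<open>C True\<close>.\<close>
  define s where "s = (B False ! i < B True ! i)"
  define C where "C c = B (c = s)" for c
  have C: "length (C c) = m" for c by (simp add: C_def B)
  have C_less: "C False ! i < C True ! i"
    using i(2) by (cases s) (auto simp: C_def s_def)
  have C_eq: "C False ! j = C True ! j" if "j < i" for j
    using i(3)[OF that] by (cases s) (auto simp: C_def)
  have subst: "word_subst m C x = word_subst m B (\<lambda>n. x n = s)" for x
    by (simp add: word_subst_def C_def)
  define Y where "Y = (\<lambda>S. z \<frown> word_subst m C (\<lambda>n. source n \<in> S))"
  have inf: "\<exists>\<^sub>\<infinity>n. ((source n \<in> S) = s) \<noteq> ((source n \<in> S') = s)" if "S \<noteq> S'" for S S'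
    by (rule INFM_mono[OF INFM_source_neq[OF that]]) auto
  have YL: "Y S \<in> L" for S unfolding Y_def subst by (rule BL)
  have YD: "D (convolution (Y S) (Y S')) = d" if "S \<noteq> S'" for S S'
    unfolding Y_def subst by (rule BD[OF inf[OF that]])
  have Yh: "h (Y S) \<noteq> h (Y S')" if "S \<noteq> S'" for S S'
    unfolding Y_def subst by (rule Bh[OF inf[OF that]])
  have "range Y = {z \<frown> word_subst m C x | x. \<forall>n. x (2 * n + 1) = x n}"
  proof -
    have "range Y = (\<lambda>x. z \<frown> word_subst m C x) ` range (\<lambda>S n. source n \<in> S)"
      unfolding Y_def image_image by (rule refl)
    then show ?thesis unfolding range_source by blast
  qed
  moreover have "C False \<noteq> C True" using C_less by auto
  ultimately have coCF: "range Y \<in> co_omega_erCF"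
    using co_omega_erCF_self_similar[of C m z] C m by simp
  have Lambda: "range Y \<in> Lambda_class"
    unfolding Y_def by (intro real_embeds_in_range less_fun_word_subst[OF C i(1) C_less C_eq])
  have E: "\<exists>i\<in>{1..l}. {h (Y S), h (Y S')} \<in> E i" if "S \<noteq> S'" for S S'
  proof -
    have "{h (Y S), h (Y S')} \<in> [V]\<^bsup>2\<^esup>"
      using YL Yh[OF that] V by (auto simp: nsets_def)
    then show ?thesis using assms(2) unfolding two_partition_def by blast
  qed
  \<comment> \<open>All pairs of distinct sets give the colour \<open>d\<close>, so the class found
    for one such pair serves for all.\<close>
  obtain k where k: "k \<in> {1..l}" "{h (Y {}), h (Y UNIV)} \<in> E k" using E[of "{}" UNIV] by auto
  then have "k \<in> D (convolution (Y {}) (Y UNIV))" using YL by (simp add: D R_def)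
  then have kd: "k \<in> d" using YD[of "{}" UNIV] by simp
  have "[h ` range Y]\<^bsup>2\<^esup> \<subseteq> E k"
  proof
    fix e assume e: "e \<in> [h ` range Y]\<^bsup>2\<^esup>"
    then obtain S S' where S: "e = {h (Y S), h (Y S')}" "h (Y S) \<noteq> h (Y S')"
      by (auto simp: nsets_def card_2_iff)
    then have "k \<in> D (convolution (Y S) (Y S'))" using kd YD[of S S'] by auto
    then show "e \<in> E k" using k(1) S(1) by (simp add: D R_def)
  qed
  then have "homogeneous l V E (h ` range Y)"
    using k(1) YL V unfolding homogeneous_def by blast
  moreover have "has_size_continuum (h ` range Y)"
  proof -
    have "inj (h \<circ> Y)" using Yh by (auto simp: inj_def)
    then have "bij_betw (h \<circ> Y) UNIV (h ` range Y)" by (simp add: bij_betw_def image_comp)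
    then show ?thesis unfolding has_size_continuum_def using eqpoll_def eqpoll_sym by blast
  qed
  ultimately show ?thesis using coCF Lambda YL by (intro exI[of _ "range Y"]) auto
qed

end
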